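(* Let $H$ be a separable Hilbert space and $\mathcal{K}(H)$ the algebra of all compact operators on $H$. Then $\overline{\mathcal{D}_{Lie}(\mathcal{K}(H))}=\overline{\mathcal{M}_{Lie}(\mathcal{K}(H))}$, where the closures are taken in the norm of the algebra of all bounded operators on the Banach space $\mathcal{K}(H)$.
   Context: Write $A=\mathcal{K}(H)$ and $\widetilde{A}=\mathcal{K}(H)+\mathbb{C}1\subset B(H)$. For $a\in\widetilde{A}$ let $L_a,R_a$ be the operators $L_ax=ax$, $R_ax=xa$ on $A$. $\mathcal{D}_{Lie}(A)$ is the algebra of operators on $A$ generated (without adjoining the identity) by all inner derivations $L_a-R_a$, $a\in A$. $\mathcal{M}_{Lie}(A)$ is the algebra of all elementary operators on $A$ that can be written as finite sums $\sum_k L_{a_k}R_{b_k}$ with $a_k,b_k\in\widetilde{A}$, $\sum_k a_kb_k=0$ and $\sum_k b_ka_k=0$. *)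

theory Defs
  imports "HOL-Analysis.Analysis"
begin

section \<open>Complex Hilbert spaces\<close>

text \<open>The libraries only provide real normed and real inner product spaces. The classes below add
  a complex scalar multiplication extending the real one. The inner product is linear in its
  first argument.\<close>

class scaleC = scaleR +
  fixes scaleC :: "complex \<Rightarrow> 'a \<Rightarrow> 'a"  (infixr \<open>*\<^sub>C\<close> 75)

class complex_normed_vector = real_normed_vector + scaleC +
  assumes scaleR_scaleC: "r *\<^sub>R x = complex_of_real r *\<^sub>C x"
    and scaleC_add_right: "c *\<^sub>C (x + y) = c *\<^sub>C x + c *\<^sub>C y"
    and scaleC_add_left: "(c + d) *\<^sub>C x = c *\<^sub>C x + d *\<^sub>C x"
    and scaleC_scaleC: "c *\<^sub>C d *\<^sub>C x = (c * d) *\<^sub>C x"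
    and norm_scaleC: "norm (c *\<^sub>C x) = cmod c * norm x"

class complex_inner = complex_normed_vector +
  fixes cinner :: "'a \<Rightarrow> 'a \<Rightarrow> complex"
  assumes cinner_commute: "cinner x y = cnj (cinner y x)"
    and cinner_add_left: "cinner (x + y) z = cinner x z + cinner y z"
    and cinner_scaleC_left: "cinner (c *\<^sub>C x) y = c * cinner x y"
    and cinner_self: "cinner x x = complex_of_real ((norm x)\<^sup>2)"

class complex_hilbert_space = complex_inner + complete_space

instantiation complex :: complex_hilbert_space
begin

definition scaleC_complex :: "complex \<Rightarrow> complex \<Rightarrow> complex"
  where "scaleC_complex c x = c * x"

definition cinner_complex :: "complex \<Rightarrow> complex \<Rightarrow> complex"
  where "cinner_complex x y = x * cnj y"

instance
  by standard
    (simp_all add: scaleC_complex_def cinner_complex_def scaleR_conv_of_real algebra_simps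
      norm_mult complex_norm_square [symmetric])

end

lemma scaleC_one [simp]: "1 *\<^sub>C x = (x :: 'a :: complex_normed_vector)"
  using scaleR_scaleC [of 1 x] by simp

lemma scaleC_zero_left [simp]: "0 *\<^sub>C x = (0 :: 'a :: complex_normed_vector)"
  using scaleR_scaleC [of 0 x] by simp

lemma bounded_linear_scaleC: "bounded_linear (\<lambda>x :: 'a :: complex_normed_vector. c *\<^sub>C x)"
  by (rule bounded_linear_intro [where K = "cmod c"])
    (simp_all add: scaleC_add_right scaleR_scaleC scaleC_scaleC norm_scaleC mult.commute)

instantiation blinfun :: (real_normed_vector, complex_normed_vector) complex_normed_vector
begin

lift_definition scaleC_blinfun :: "complex \<Rightarrow> 'a \<Rightarrow>\<^sub>L 'b \<Rightarrow> 'a \<Rightarrow>\<^sub>L 'b"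
  is "\<lambda>c f x. c *\<^sub>C f x"
  by (rule bounded_linear_compose [OF bounded_linear_scaleC])

instance
proof
  fix c d :: complex and r :: real and f g :: "'a \<Rightarrow>\<^sub>L 'b"
  show "r *\<^sub>R f = complex_of_real r *\<^sub>C f"
    by transfer (simp add: scaleR_scaleC)
  show "c *\<^sub>C (f + g) = c *\<^sub>C f + c *\<^sub>C g"
    by transfer (simp add: scaleC_add_right)
  show "(c + d) *\<^sub>C f = c *\<^sub>C f + d *\<^sub>C f"
    by transfer (simp add: scaleC_add_left)
  show sc: "c *\<^sub>C d *\<^sub>C f = (c * d) *\<^sub>C f" for c d and f :: "'a \<Rightarrow>\<^sub>L 'b"
    by transfer (simp add: scaleC_scaleC)
  have le: "norm (c *\<^sub>C f) \<le> cmod c * norm f" for c and f :: "'a \<Rightarrow>\<^sub>L 'b"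
  proof (rule norm_blinfun_bound)
    show "norm (blinfun_apply (c *\<^sub>C f) x) \<le> cmod c * norm f * norm x" for x
      using mult_left_mono [OF norm_blinfun [of f x], of "cmod c"]
      by (simp add: scaleC_blinfun.rep_eq norm_scaleC mult.assoc)
  qed simp
  show "norm (c *\<^sub>C f) = cmod c * norm f"
  proof (cases "c = 0")
    case True
    have "c *\<^sub>C f = 0"
      using True by transfer simp
    then show ?thesis using True by simp
  next
    case False
    have "1 *\<^sub>C f = f" by transfer simp
    then have "f = inverse c *\<^sub>C c *\<^sub>C f"
      using False by (simp add: sc)
    then have "norm f \<le> cmod (inverse c) * norm (c *\<^sub>C f)"
      using le by metis
    then have "cmod c * norm f \<le> norm (c *\<^sub>C f)"
      using False by (simp add: norm_divide field_simps)
    with le [of c f] show ?thesis by simp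
  qed
qed

end

lemma blinfun_apply_scaleC [simp]: "blinfun_apply (c *\<^sub>C f) x = c *\<^sub>C blinfun_apply f x"
  by (simp add: scaleC_blinfun.rep_eq)


section \<open>Bounded and compact operators\<close>

text \<open>The type of bounded linear maps consists of the real-linear ones; the complex-linear ones
  are singled out as a subset.\<close>

definition bounded_ops :: "('a :: complex_normed_vector \<Rightarrow>\<^sub>L 'b :: complex_normed_vector) set"
  where "bounded_ops = {T. \<forall>c x. blinfun_apply T (c *\<^sub>C x) = c *\<^sub>C blinfun_apply T x}"

text \<open>Since this subset is closed, the closure of a set of complex-linear operators is the same
  whether formed in \<open>bounded_ops\<close> or in the ambient type.\<close>

lemma closed_bounded_ops:
  "closed (bounded_ops :: ('a :: complex_normed_vector \<Rightarrow>\<^sub>L 'b :: complex_normed_vector) set)"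
proof -
  have "continuous_on UNIV (\<lambda>T :: 'a \<Rightarrow>\<^sub>L 'b. c *\<^sub>C blinfun_apply T x)" for c x
    by (intro bounded_linear.continuous_on [OF bounded_linear_scaleC] continuous_intros)
  then show ?thesis
    unfolding bounded_ops_def
    by (intro closed_Collect_all closed_Collect_eq continuous_intros)
qed

definition compact_ops :: "('a :: complex_normed_vector \<Rightarrow>\<^sub>L 'b :: complex_normed_vector) set"
  where "compact_ops = {T \<in> bounded_ops. compact (closure (blinfun_apply T ` cball 0 1))}"

lemma compact_closure_subset:
  fixes S :: "'a :: metric_space set"
  assumes "S \<subseteq> K" "compact K"
  shows "compact (closure S)"
proof -
  have "closure S \<subseteq> K"
    using assms by (simp add: closure_minimal compact_imp_closed)
  then show ?thesis
    using compact_Int_closed [OF assms(2) closed_closure, of S] by (simp add: Int_absorb1)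
qed

lemma zero_in_compact_ops:
  "(0 :: 'a :: complex_normed_vector \<Rightarrow>\<^sub>L 'b :: complex_normed_vector) \<in> compact_ops"
proof -
  have "blinfun_apply (0 :: 'a \<Rightarrow>\<^sub>L 'b) ` cball 0 1 \<subseteq> {0}" by auto
  then have "compact (closure (blinfun_apply (0 :: 'a \<Rightarrow>\<^sub>L 'b) ` cball 0 1))"
    by (rule compact_closure_subset) simp
  moreover have "(c :: complex) *\<^sub>C (0 :: 'b) = 0" for c
    using norm_scaleC [of c "0 :: 'b"] by simp
  ultimately show ?thesis
    by (simp add: compact_ops_def bounded_ops_def)
qed

lemma add_in_compact_ops:
  assumes "S \<in> compact_ops" "T \<in> compact_ops"
  shows "S + T \<in> compact_ops"
proof -
  let ?C = "\<lambda>U. closure (blinfun_apply U ` cball 0 1)"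
  have *: "compact {x + y | x y. x \<in> ?C S \<and> y \<in> ?C T}"
    using assms by (intro compact_sums) (auto simp: compact_ops_def)
  have "blinfun_apply (S + T) ` cball 0 1 \<subseteq> {x + y | x y. x \<in> ?C S \<and> y \<in> ?C T}"
    using closure_subset [of "blinfun_apply S ` cball 0 1"]
      closure_subset [of "blinfun_apply T ` cball 0 1"]
    unfolding image_subset_iff blinfun.add_left by blast
  then have "compact (?C (S + T))"
    using * by (rule compact_closure_subset)
  then show ?thesis
    using assms unfolding compact_ops_def bounded_ops_def
    by (simp add: blinfun.add_left scaleC_add_right)
qed

lemma bounded_ops_compose:
  assumes "S \<in> bounded_ops" "T \<in> bounded_ops"
  shows "S o\<^sub>L T \<in> bounded_ops"
  using assms by (simp add: bounded_ops_def)

lemma compose_left_in_compact_ops: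
  assumes "S \<in> bounded_ops" "T \<in> compact_ops"
  shows "S o\<^sub>L T \<in> compact_ops"
proof -
  have "compact (blinfun_apply S ` closure (blinfun_apply T ` cball 0 1))"
    using assms
    by (intro compact_continuous_image continuous_intros) (auto simp: compact_ops_def)
  moreover have "blinfun_apply (S o\<^sub>L T) ` cball 0 1
      \<subseteq> blinfun_apply S ` closure (blinfun_apply T ` cball 0 1)"
    unfolding image_subset_iff blinfun_apply_blinfun_compose
    using closure_subset [of "blinfun_apply T ` cball 0 1"] by blast
  ultimately show ?thesis
    using assms unfolding compact_ops_def
    by (simp add: bounded_ops_compose compact_closure_subset)
qed

lemma compose_right_in_compact_ops:
  fixes T :: "'c :: complex_normed_vector \<Rightarrow>\<^sub>L 'a :: complex_normed_vector"
  assumes "S \<in> compact_ops" "T \<in> bounded_ops"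
  shows "S o\<^sub>L T \<in> compact_ops"
proof -
  let ?C = "closure (blinfun_apply S ` cball 0 1)"
  define r where "r = norm T + 1"
  have r: "r > 0" by (simp add: r_def add_nonneg_pos)
  have *: "compact ((\<lambda>y. r *\<^sub>R y) ` ?C)"
    using assms by (intro compact_scaling) (auto simp: compact_ops_def)
  have "blinfun_apply (S o\<^sub>L T) ` cball 0 1 \<subseteq> (\<lambda>y. r *\<^sub>R y) ` ?C"
  proof (rule image_subsetI)
    fix x :: 'c assume "x \<in> cball 0 1"
    then have "norm T * norm x \<le> norm T * 1"
      by (intro mult_left_mono) simp_all
    then have "norm (blinfun_apply T x) \<le> r"
      using norm_blinfun [of T x] unfolding r_def by linarith
    then have "inverse r *\<^sub>R blinfun_apply T x \<in> cball 0 1"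
      using r by (simp add: divide_simps)
    then have "blinfun_apply S (inverse r *\<^sub>R blinfun_apply T x) \<in> ?C"
      by (intro subsetD [OF closure_subset] imageI)
    moreover have "blinfun_apply (S o\<^sub>L T) x
        = r *\<^sub>R blinfun_apply S (inverse r *\<^sub>R blinfun_apply T x)"
      using r by (simp add: blinfun.scaleR_right)
    ultimately show "blinfun_apply (S o\<^sub>L T) x \<in> (\<lambda>y. r *\<^sub>R y) ` ?C"
      by (rule rev_image_eqI)
  qed
  then have "compact (closure (blinfun_apply (S o\<^sub>L T) ` cball 0 1))"
    using * by (rule compact_closure_subset)
  then show ?thesis
    using assms unfolding compact_ops_def by (simp add: bounded_ops_compose)
qed

lemma scaleC_id_in_bounded_ops: "c *\<^sub>C id_blinfun \<in> bounded_ops"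
  by (simp add: bounded_ops_def scaleC_scaleC mult.commute)

lemma scaleC_in_compact_ops:
  assumes "T \<in> compact_ops"
  shows "c *\<^sub>C T \<in> compact_ops"
proof -
  have "c *\<^sub>C T = (c *\<^sub>C id_blinfun) o\<^sub>L T"
    by (rule blinfun_eqI) simp
  then show ?thesis
    using compose_left_in_compact_ops [OF scaleC_id_in_bounded_ops assms] by simp
qed

lemma scaleR_in_compact_ops: "T \<in> compact_ops \<Longrightarrow> r *\<^sub>R T \<in> compact_ops"
  by (simp add: scaleR_scaleC scaleC_in_compact_ops)

lemma uminus_in_compact_ops: "T \<in> compact_ops \<Longrightarrow> - T \<in> compact_ops"
  using scaleR_in_compact_ops [of T "-1"] by simp

lemma minus_in_compact_ops: "S \<in> compact_ops \<Longrightarrow> T \<in> compact_ops \<Longrightarrow> S - T \<in> compact_ops"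
  using add_in_compact_ops [OF _ uminus_in_compact_ops, of S T] by simp

text \<open>The space \<open>K(H)\<close> as a type, so that the bounded operators on it form a library type as
  well. It carries the operator norm inherited from \<open>B(H)\<close>.\<close>

typedef (overloaded) 'h compact_op =
  "compact_ops :: ('h :: complex_hilbert_space \<Rightarrow>\<^sub>L 'h) set"
  morphisms op_of Compact_op
  using zero_in_compact_ops by blast

setup_lifting type_definition_compact_op

instantiation compact_op :: (complex_hilbert_space) real_normed_vector
begin

lift_definition zero_compact_op :: "'a compact_op" is 0
  by (rule zero_in_compact_ops)

lift_definition plus_compact_op :: "'a compact_op \<Rightarrow> 'a compact_op \<Rightarrow> 'a compact_op" is "(+)"
  by (rule add_in_compact_ops)

lift_definition minus_compact_op :: "'a compact_op \<Rightarrow> 'a compact_op \<Rightarrow> 'a compact_op" is "(-)"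
  by (rule minus_in_compact_ops)

lift_definition uminus_compact_op :: "'a compact_op \<Rightarrow> 'a compact_op" is uminus
  by (rule uminus_in_compact_ops)

lift_definition scaleR_compact_op :: "real \<Rightarrow> 'a compact_op \<Rightarrow> 'a compact_op" is scaleR
  by (rule scaleR_in_compact_ops)

lift_definition norm_compact_op :: "'a compact_op \<Rightarrow> real" is norm .

definition dist_compact_op :: "'a compact_op \<Rightarrow> 'a compact_op \<Rightarrow> real"
  where "dist_compact_op a b = norm (a - b)"

definition sgn_compact_op :: "'a compact_op \<Rightarrow> 'a compact_op"
  where "sgn_compact_op a = scaleR (inverse (norm a)) a"

definition uniformity_compact_op :: "('a compact_op \<times> 'a compact_op) filter"
  where [code del]: "uniformity_compact_op = (INF e\<in>{0 <..}. principal {(x, y). dist x y < e})"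

definition open_compact_op :: "'a compact_op set \<Rightarrow> bool"
  where [code del]:
    "open_compact_op S = (\<forall>x\<in>S. \<forall>\<^sub>F (x', y) in uniformity. x' = x \<longrightarrow> y \<in> S)"

instance
proof
  fix a b c :: "'a compact_op" and r s :: real
  show "a + b + c = a + (b + c)" by transfer (simp add: add.assoc)
  show "a + b = b + a" by transfer (simp add: add.commute)
  show "0 + a = a" by transfer simp
  show "- a + a = 0" by transfer simp
  show "a - b = a + - b" by transfer simp
  show "r *\<^sub>R (a + b) = r *\<^sub>R a + r *\<^sub>R b" by transfer (simp add: scaleR_add_right)
  show "(r + s) *\<^sub>R a = r *\<^sub>R a + s *\<^sub>R a" by transfer (simp add: scaleR_add_left)
  show "r *\<^sub>R s *\<^sub>R a = (r * s) *\<^sub>R a" by transfer simp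
  show "1 *\<^sub>R a = a" by transfer simp
  show "sgn a = inverse (norm a) *\<^sub>R a" by (rule sgn_compact_op_def)
  show "dist a b = norm (a - b)" by (rule dist_compact_op_def)
  show "(uniformity :: ('a compact_op \<times> 'a compact_op) filter)
      = (INF e\<in>{0 <..}. principal {(x, y). dist x y < e})"
    by (rule uniformity_compact_op_def)
  show "open U = (\<forall>x\<in>U. \<forall>\<^sub>F (x', y) in uniformity. x' = x \<longrightarrow> y \<in> U)"
    for U :: "'a compact_op set"
    by (rule open_compact_op_def)
  show "norm a = 0 \<longleftrightarrow> a = 0" by transfer simp
  show "norm (a + b) \<le> norm a + norm b" by transfer (rule norm_triangle_ineq)
  show "norm (r *\<^sub>R a) = \<bar>r\<bar> * norm a" by transfer simp
qed

end

instantiation compact_op :: (complex_hilbert_space) complex_normed_vector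
begin

lift_definition scaleC_compact_op :: "complex \<Rightarrow> 'a compact_op \<Rightarrow> 'a compact_op" is scaleC
  by (rule scaleC_in_compact_ops)

instance
proof
  fix a b :: "'a compact_op" and r :: real and z w :: complex
  show "r *\<^sub>R a = complex_of_real r *\<^sub>C a" by transfer (rule scaleR_scaleC)
  show "z *\<^sub>C (a + b) = z *\<^sub>C a + z *\<^sub>C b" by transfer (rule scaleC_add_right)
  show "(z + w) *\<^sub>C a = z *\<^sub>C a + w *\<^sub>C a" by transfer (rule scaleC_add_left)
  show "z *\<^sub>C w *\<^sub>C a = (z * w) *\<^sub>C a" by transfer (rule scaleC_scaleC)
  show "norm (z *\<^sub>C a) = cmod z * norm a" by transfer (rule norm_scaleC)
qed

end


section \<open>Operators on \<open>K(H)\<close>\<close>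

definition unitization :: "('h :: complex_hilbert_space \<Rightarrow>\<^sub>L 'h) set"
  where "unitization = {op_of x + c *\<^sub>C id_blinfun | x c. True}"

lemma unitization_subset_bounded_ops:
  "(unitization :: ('h :: complex_hilbert_space \<Rightarrow>\<^sub>L 'h) set) \<subseteq> bounded_ops"
proof
  fix a :: "'h \<Rightarrow>\<^sub>L 'h" assume "a \<in> unitization"
  then obtain x c where "a = op_of x + c *\<^sub>C id_blinfun"
    by (auto simp: unitization_def)
  moreover have "op_of x \<in> bounded_ops"
    using op_of [of x] by (simp add: compact_ops_def)
  ultimately show "a \<in> bounded_ops"
    using scaleC_id_in_bounded_ops [of c]
    by (simp add: bounded_ops_def blinfun.add_left scaleC_add_right)
qed

text \<open>The next two definitions are meaningful for every \<open>a\<close> in \<open>bounded_ops\<close>, as the lemmas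
  following them show, and will only be used for \<open>a\<close> in \<open>unitization\<close>.\<close>

definition left_mult :: "('h :: complex_hilbert_space \<Rightarrow>\<^sub>L 'h) \<Rightarrow> 'h compact_op \<Rightarrow>\<^sub>L 'h compact_op"
  where "left_mult a = Blinfun (\<lambda>x. Compact_op (a o\<^sub>L op_of x))"

definition right_mult :: "('h :: complex_hilbert_space \<Rightarrow>\<^sub>L 'h) \<Rightarrow> 'h compact_op \<Rightarrow>\<^sub>L 'h compact_op"
  where "right_mult a = Blinfun (\<lambda>x. Compact_op (op_of x o\<^sub>L a))"

lemma bounded_linear_into_compact_op:
  assumes "bounded_linear f" "\<And>x. f (op_of x) \<in> compact_ops"
  shows "bounded_linear (\<lambda>x. Compact_op (f (op_of x)))"
proof -
  interpret bounded_linear f by fact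
  obtain K where "\<And>x. norm (f x) \<le> norm x * K" using bounded by blast
  then show ?thesis
    using assms(2)
      add_in_compact_ops [OF assms(2) assms(2)] scaleR_in_compact_ops [OF assms(2)]
    by (intro bounded_linear_intro [where K = K])
      (simp_all add: op_of_inject [symmetric] Compact_op_inverse plus_compact_op.rep_eq
        scaleR_compact_op.rep_eq norm_compact_op.rep_eq add scaleR)
qed

lemma op_of_left_mult:
  assumes "a \<in> bounded_ops"
  shows "op_of (blinfun_apply (left_mult a) x) = a o\<^sub>L op_of x"
proof -
  have "a o\<^sub>L op_of x \<in> compact_ops" for x
    by (rule compose_left_in_compact_ops [OF assms op_of])
  then show ?thesis
    unfolding left_mult_def
    by (simp add: bounded_linear_Blinfun_apply bounded_linear_into_compact_op Compact_op_inverse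
        bounded_bilinear.bounded_linear_right [OF bounded_bilinear_blinfun_compose])
qed

lemma op_of_right_mult:
  assumes "a \<in> bounded_ops"
  shows "op_of (blinfun_apply (right_mult a) x) = op_of x o\<^sub>L a"
proof -
  have mem: "op_of x o\<^sub>L a \<in> compact_ops" for x
    by (rule compose_right_in_compact_ops [OF op_of assms])
  have lin: "bounded_linear (\<lambda>y. y o\<^sub>L a)"
    by (rule bounded_bilinear.bounded_linear_left [OF bounded_bilinear_blinfun_compose])
  show ?thesis
    unfolding right_mult_def
    using mem bounded_linear_into_compact_op [OF lin mem]
    by (simp add: bounded_linear_Blinfun_apply Compact_op_inverse)
qed

text \<open>Complex subalgebras, not required to contain the identity operator.\<close>

definition subalgebra :: "('a :: complex_normed_vector \<Rightarrow>\<^sub>L 'a) set \<Rightarrow> bool"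
  where "subalgebra B \<longleftrightarrow> 0 \<in> B \<and> (\<forall>S\<in>B. \<forall>T\<in>B. S + T \<in> B) \<and> (\<forall>c. \<forall>T\<in>B. c *\<^sub>C T \<in> B)
    \<and> (\<forall>S\<in>B. \<forall>T\<in>B. S o\<^sub>L T \<in> B)"

definition inner_derivation :: "'h :: complex_hilbert_space compact_op \<Rightarrow> 'h compact_op \<Rightarrow>\<^sub>L 'h compact_op"
  where "inner_derivation a = left_mult (op_of a) - right_mult (op_of a)"

definition D_Lie :: "('h :: complex_hilbert_space compact_op \<Rightarrow>\<^sub>L 'h compact_op) set"
  where "D_Lie = subalgebra hull range inner_derivation"

definition M_Lie :: "('h :: complex_hilbert_space compact_op \<Rightarrow>\<^sub>L 'h compact_op) set"
  where "M_Lie = {\<Sum>k<n. left_mult (a k) o\<^sub>L right_mult (b k) | (n :: nat) a b.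
    (\<forall>k<n. a k \<in> unitization \<and> b k \<in> unitization) \<and>
    (\<Sum>k<n. a k o\<^sub>L b k) = 0 \<and> (\<Sum>k<n. b k o\<^sub>L a k) = 0}"

end

theory Submission
  imports Defs
begin

text \<open>If \<open>x\<close> and \<open>y\<close> have rank one and \<open>x y = y x = 0\<close>, then \<open>L\<^sub>x R\<^sub>y\<close> is a polynomial without constant
  term in the inner derivations \<open>ad x\<close> and \<open>ad y\<close>, up to polarization. Now
  \<open>L\<^sub>x R\<^sub>y z = f(z v) (u \<otimes> g)\<close> for \<open>x = u \<otimes> f\<close>, \<open>y = v \<otimes> g\<close>, and the condition says that \<open>v \<otimes> f\<close> and
  \<open>u \<otimes> g\<close> have trace zero. Subtracting multiples of a normalized projection of rank \<open>m\<close> makes the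
  traces vanish, so for finite-rank \<open>x\<^sub>k\<close>, \<open>y\<^sub>k\<close> the distance of \<open>\<Sum> x\<^sub>k \<otimes> y\<^sub>k\<close> from the algebra
  generated by derivations is at most \<open>norm (\<Sum> x\<^sub>k y\<^sub>k) + O(1/m)\<close>. In infinite dimension \<open>m\<close> is arbitrary, and approximating
  compact operators by finite-rank ones handles all compact \<open>x\<^sub>k\<close>, \<open>y\<^sub>k\<close> with \<open>\<Sum> x\<^sub>k y\<^sub>k = 0\<close>. The scalar
  parts of the coefficients are removed by adding derivations and products of two derivations,
  because the identity is not compact. In finite dimension the trace corrections vanish exactly.\<close>

section \<open>Complex scalars and identities for the inner product\<close>

interpretation complex_vector: vector_space "scaleC :: complex \<Rightarrow> 'a \<Rightarrow> 'a :: complex_normed_vector"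
  by standard (simp_all add: scaleC_add_right scaleC_add_left scaleC_scaleC)

lemmas scaleC_simps = scaleC_add_right scaleC_add_left scaleC_scaleC
  complex_vector.scale_right_diff_distrib complex_vector.scale_left_diff_distrib

lemma cinner_zero_left [simp]: "cinner 0 x = 0"
  using cinner_add_left [of 0 0 x] by simp

lemma cinner_minus_left: "cinner (- x) y = - cinner x y"
  using cinner_add_left [of x "- x" y] by (simp add: eq_neg_iff_add_eq_0 add.commute)

lemma cinner_diff_left: "cinner (x - y) z = cinner x z - cinner y z"
  using cinner_add_left [of x "- y" z] by (simp add: cinner_minus_left)

lemma cinner_sum_left: "cinner (sum f A) z = (\<Sum>i\<in>A. cinner (f i) z)"
  by (induction A rule: infinite_finite_induct) (simp_all add: cinner_add_left)

lemma cinner_add_right: "cinner x (y + z) = cinner x y + cinner x z"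
  by (metis cinner_add_left cinner_commute complex_cnj_add)

lemma cinner_scaleC_right: "cinner x (c *\<^sub>C y) = cnj c * cinner x y"
  by (metis cinner_commute cinner_scaleC_left complex_cnj_mult)

lemma cinner_zero_right [simp]: "cinner x 0 = 0"
  using cinner_add_right [of x 0 0] by simp

lemma cinner_sum_right: "cinner z (sum f A) = (\<Sum>i\<in>A. cinner z (f i))"
  by (induction A rule: infinite_finite_induct) (simp_all add: cinner_add_right)

lemma norm_add_orthogonal:
  assumes "cinner x y = 0"
  shows "(norm (x + y))\<^sup>2 = (norm x)\<^sup>2 + (norm y)\<^sup>2"
proof -
  have "cinner y x = 0"
    using assms by (subst cinner_commute) simp
  then have "complex_of_real ((norm (x + y))\<^sup>2) = complex_of_real ((norm x)\<^sup>2 + (norm y)\<^sup>2)"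
    using assms by (simp only: cinner_self [symmetric] of_real_add)
      (simp add: cinner_add_left cinner_add_right)
  then show ?thesis by (simp only: of_real_eq_iff)
qed

section \<open>Finite orthonormal sets\<close>

definition orthonormal :: "'h :: complex_hilbert_space set \<Rightarrow> bool"
  where "orthonormal W \<longleftrightarrow> finite W \<and> (\<forall>v\<in>W. \<forall>w\<in>W. cinner v w = (if v = w then 1 else 0))"

definition proj :: "'h :: complex_hilbert_space set \<Rightarrow> 'h \<Rightarrow> 'h"
  where "proj W x = (\<Sum>w\<in>W. cinner x w *\<^sub>C w)"

lemma cinner_proj:
  assumes "orthonormal W" "w \<in> W"
  shows "cinner (proj W x) w = cinner x w"
proof -
  have "cinner (proj W x) w = (\<Sum>v\<in>W. if w = v then cinner x v else 0)"
    using assms unfolding proj_def cinner_sum_left cinner_scaleC_left orthonormal_def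
    by (intro sum.cong) auto
  then show ?thesis
    using assms by (simp add: orthonormal_def sum.delta)
qed

lemma proj_add: "proj W (x + y) = proj W x + proj W y"
  by (simp add: proj_def cinner_add_left scaleC_add_left sum.distrib)

lemma proj_diff: "proj W (x - y) = proj W x - proj W y"
  by (simp add: proj_def cinner_diff_left complex_vector.scale_left_diff_distrib sum_subtractf)

lemma proj_scaleC: "proj W (c *\<^sub>C x) = c *\<^sub>C proj W x"
  by (simp add: proj_def cinner_scaleC_left complex_vector.scale_sum_right scaleC_scaleC)

lemma proj_proj: "orthonormal W \<Longrightarrow> proj W (proj W x) = proj W x"
  unfolding proj_def [of W "proj W x"] proj_def [of W x, symmetric]
  by (simp add: cinner_proj cong: sum.cong) (simp add: proj_def)

text \<open>Pythagoras: the residual \<open>x - proj W x\<close> is orthogonal to every member of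
  \<open>W\<close>, hence to \<open>proj W x\<close>.\<close>

lemma norm_proj_decomp:
  assumes "orthonormal W"
  shows "(norm x)\<^sup>2 = (norm (proj W x))\<^sup>2 + (norm (x - proj W x))\<^sup>2"
proof -
  have "cinner (x - proj W x) (proj W x) = 0"
    by (subst (2) proj_def)
      (simp add: cinner_sum_right cinner_scaleC_right cinner_diff_left cinner_proj assms)
  then have "cinner (proj W x) (x - proj W x) = 0"
    by (subst cinner_commute) simp
  from norm_add_orthogonal [OF this] show ?thesis by simp
qed

lemma norm_proj_le: "orthonormal W \<Longrightarrow> norm (proj W x) \<le> norm x"
  by (rule power2_le_imp_le) (simp_all add: norm_proj_decomp [of W x])

lemma norm_diff_proj_le: "orthonormal W \<Longrightarrow> norm (x - proj W x) \<le> norm x"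
  by (rule power2_le_imp_le) (simp_all add: norm_proj_decomp [of W x])

lemma orthonormal_empty: "orthonormal {}"
  by (simp add: orthonormal_def)

lemma norm_orthonormal: "orthonormal W \<Longrightarrow> w \<in> W \<Longrightarrow> norm w = 1"
proof -
  assume "orthonormal W" "w \<in> W"
  then have "complex_of_real ((norm w)\<^sup>2) = complex_of_real 1"
    unfolding orthonormal_def by (simp only: cinner_self [symmetric]) simp
  then have "(norm w)\<^sup>2 = 1\<^sup>2" by (simp only: of_real_eq_iff power_one)
  then show "norm w = 1" by (rule power2_eq_imp_eq) simp_all
qed

lemma orthonormal_singleton: "norm w = 1 \<Longrightarrow> orthonormal {w}"
  using cinner_self [of w] by (simp add: orthonormal_def)

text \<open>Cauchy-Schwarz, obtained from contractivity of the projection onto the line of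
  \<open>y\<close>.\<close>

lemma cmod_cinner_le:
  fixes x :: "'h :: complex_hilbert_space"
  shows "cmod (cinner x y) \<le> norm x * norm y"
proof (cases "y = 0")
  case False
  define w where "w = complex_of_real (inverse (norm y)) *\<^sub>C y"
  have w: "norm w = 1"
    using False by (simp add: w_def norm_scaleC norm_inverse)
  have "norm (proj {w} x) \<le> norm x"
    by (rule norm_proj_le [OF orthonormal_singleton [OF w]])
  then have "cmod (cinner x w) \<le> norm x"
    using w by (simp add: proj_def norm_scaleC)
  then show ?thesis
    using False by (simp add: w_def cinner_scaleC_right norm_mult norm_divide field_simps)
qed simp

text \<open>One Gram-Schmidt step: \<open>w\<close> is the normalized residual of \<open>y\<close>.
  The enlarged projection fixes both the residual and \<open>proj W y\<close>, hence their sum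
  \<open>y\<close>.\<close>

lemma orthonormal_extend:
  fixes y :: "'h :: complex_hilbert_space"
  assumes W: "orthonormal W" and y: "proj W y \<noteq> y"
  obtains w where "w \<notin> W" "orthonormal (insert w W)" "proj (insert w W) y = y"
proof
  define r where "r = y - proj W y"
  define w where "w = complex_of_real (inverse (norm r)) *\<^sub>C r"
  have r: "r \<noteq> 0" using y by (simp add: r_def)
  have rW: "cinner r v = 0" if "v \<in> W" for v
    using that W by (simp add: r_def cinner_diff_left cinner_proj)
  have wW: "cinner w v = 0" if "v \<in> W" for v
    using rW [OF that] by (simp add: w_def cinner_scaleC_left)
  then have Ww: "cinner v w = 0" if "v \<in> W" for v
    using that by (subst cinner_commute) simp
  have ww: "cinner w w = 1"
    using r by (simp add: cinner_self w_def norm_scaleC norm_inverse)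
  show w: "w \<notin> W" using wW ww by auto
  show W': "orthonormal (insert w W)"
    using W wW Ww ww w unfolding orthonormal_def by auto
  have "proj (insert w W) r = cinner r w *\<^sub>C w"
    using W w rW by (simp add: proj_def orthonormal_def)
  also have "\<dots> = r"
    using r by (simp add: w_def cinner_scaleC_right scaleC_scaleC cinner_self power2_eq_square
        mult.commute mult.left_commute)
  finally have 1: "proj (insert w W) r = r" .
  have "proj (insert w W) (proj W y) = proj W (proj W y)"
  proof -
    have "cinner (proj W y) w = 0"
      by (simp add: proj_def cinner_sum_left cinner_scaleC_left Ww)
    then show ?thesis
      using W w by (simp add: proj_def [of "insert w W"] orthonormal_def) (simp add: proj_def)
  qed
  then have 2: "proj (insert w W) (proj W y) = proj W y"
    by (simp add: proj_proj W)
  have "y = proj W y + r" by (simp add: r_def)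
  then show "proj (insert w W) y = y"
    using 1 2 by (metis proj_add)
qed

text \<open>Members of \<open>W\<close> outside \<open>V\<close> are orthogonal to the span of
  \<open>V\<close>, so they add nothing to the projection of \<open>x\<close>.\<close>

lemma proj_mono:
  assumes "orthonormal W" "V \<subseteq> W" "proj V x = x"
  shows "proj W x = x"
proof -
  have "cinner x w = 0" if "w \<in> W - V" for w
    using that assms(1,2)
    by (subst assms(3) [symmetric])
      (auto simp: proj_def cinner_sum_left cinner_scaleC_left orthonormal_def intro!: sum.neutral)
  then have "proj W x = proj V x"
    using assms(1,2) unfolding proj_def orthonormal_def
    by (intro sum.mono_neutral_right) auto
  then show ?thesis using assms(3) by simp
qed

text \<open>Gram-Schmidt along \<open>S\<close>; \<open>proj_mono\<close> keeps the vectors treated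
  earlier fixed when the set grows.\<close>

lemma orthonormal_fixing:
  fixes S :: "'h :: complex_hilbert_space set"
  assumes "finite S"
  shows "\<exists>W. orthonormal W \<and> (\<forall>s\<in>S. proj W s = s)"
  using assms
proof induction
  case empty
  then show ?case using orthonormal_empty by auto
next
  case (insert y S)
  then obtain W where W: "orthonormal W" "\<forall>s\<in>S. proj W s = s" by auto
  show ?case
  proof (cases "proj W y = y")
    case False
    from orthonormal_extend [OF W(1) this] obtain w
      where "orthonormal (insert w W)" "proj (insert w W) y = y" by blast
    then show ?thesis
      using W proj_mono [of "insert w W" W] by blast
  qed (use W in blast)
qed

text \<open>The hypothesis, that no finite orthonormal set spans the space, is the form in which
  infinite dimension is used from here on. It makes \<open>orthonormal_extend\<close> applicable at
  every stage.\<close>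

lemma orthonormal_card:
  assumes "\<And>W. orthonormal W \<Longrightarrow> \<exists>y :: 'h :: complex_hilbert_space. proj W y \<noteq> y"
  shows "\<exists>W :: 'h set. orthonormal W \<and> card W = n"
proof (induction n)
  case 0
  then show ?case using orthonormal_empty by fastforce
next
  case (Suc n)
  then obtain W :: "'h set" where W: "orthonormal W" "card W = n" by blast
  from assms [OF W(1)] orthonormal_extend [OF W(1)] obtain w
    where "w \<notin> W" "orthonormal (insert w W)" by metis
  moreover have "finite W" using W by (simp add: orthonormal_def)
  ultimately show ?case using W(2) by (metis card_insert_disjoint)
qed

lemma proj_bounded_linear: "orthonormal W \<Longrightarrow> bounded_linear (proj W)"
  by (intro bounded_linear_intro [where K = 1])
    (simp_all add: proj_add scaleR_scaleC proj_scaleC norm_proj_le)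

definition Proj :: "'h :: complex_hilbert_space set \<Rightarrow> 'h \<Rightarrow>\<^sub>L 'h"
  where "Proj W = Blinfun (proj W)"

lemma Proj_apply [simp]: "orthonormal W \<Longrightarrow> blinfun_apply (Proj W) x = proj W x"
  by (simp add: Proj_def bounded_linear_Blinfun_apply proj_bounded_linear)

lemma Proj_bounded_ops: "orthonormal W \<Longrightarrow> Proj W \<in> bounded_ops"
  by (simp add: bounded_ops_def proj_scaleC)

text \<open>The projection fixes a finite \<open>\<epsilon>\<close>-net of the image of the unit ball.\<close>

lemma compact_ops_proj_approx:
  fixes \<T> :: "('h :: complex_hilbert_space \<Rightarrow>\<^sub>L 'h) set"
  assumes "finite \<T>" "\<T> \<subseteq> compact_ops" "\<epsilon> > 0"
  shows "\<exists>W. orthonormal W \<and> (\<forall>T\<in>\<T>. norm (T - (Proj W o\<^sub>L T)) \<le> \<epsilon>)"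
proof -
  have "\<forall>T\<in>\<T>. \<exists>S. finite S \<and> blinfun_apply T ` cball 0 1 \<subseteq> (\<Union>s\<in>S. ball s \<epsilon>)"
  proof
    fix T assume "T \<in> \<T>"
    have "compact (closure (blinfun_apply T ` cball 0 1))"
      using \<open>T \<in> \<T>\<close> assms(2) by (auto simp: compact_ops_def)
    then have "\<exists>S. finite S \<and> closure (blinfun_apply T ` cball 0 1) \<subseteq> (\<Union>s\<in>S. ball s \<epsilon>)"
      using assms(3) unfolding compact_eq_totally_bounded by blast
    then show "\<exists>S. finite S \<and> blinfun_apply T ` cball 0 1 \<subseteq> (\<Union>s\<in>S. ball s \<epsilon>)"
      using closure_subset [of "blinfun_apply T ` cball 0 1"] by (meson subset_trans)
  qed
  from bchoice [OF this] obtain S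
    where "\<forall>T\<in>\<T>. finite (S T) \<and> blinfun_apply T ` cball 0 1 \<subseteq> (\<Union>s\<in>S T. ball s \<epsilon>)" ..
  then have S: "\<And>T. T \<in> \<T> \<Longrightarrow> finite (S T)"
      "\<And>T. T \<in> \<T> \<Longrightarrow> blinfun_apply T ` cball 0 1 \<subseteq> (\<Union>s\<in>S T. ball s \<epsilon>)"
    by blast+
  have "finite (\<Union>(S ` \<T>))" using assms(1) S(1) by blast
  from orthonormal_fixing [OF this] obtain W
    where W: "orthonormal W" "\<And>T s. T \<in> \<T> \<Longrightarrow> s \<in> S T \<Longrightarrow> proj W s = s" by blast
  have unit: "norm (T x - proj W (T x)) \<le> \<epsilon>" if T: "T \<in> \<T>" and x: "norm x \<le> 1" for T x
  proof -
    obtain s where s: "s \<in> S T" "norm (T x - s) < \<epsilon>"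
      using S(2) [OF T] x by (force simp: dist_norm norm_minus_commute)
    \<comment> \<open>The projection fixes \<open>s\<close>, so \<open>T x\<close> and
      \<open>T x - s\<close> have the same residual, and \<open>T x - s\<close> is shorter than
      \<epsilon>.\<close>
    have *: "T x - proj W (T x) = (T x - s) - proj W (T x - s)"
      using W(2) [OF T s(1)] by (simp add: proj_diff)
    then show ?thesis
      using norm_diff_proj_le [OF W(1), of "T x - s"] s(2) unfolding * by linarith
  qed
  have "norm (T - (Proj W o\<^sub>L T)) \<le> \<epsilon>" if "T \<in> \<T>" for T
  proof (rule norm_blinfun_bound)
    fix x
    show "norm (blinfun_apply (T - (Proj W o\<^sub>L T)) x) \<le> \<epsilon> * norm x"
    proof (cases "x = 0")
      case False
      have "norm (blinfun_apply (T - (Proj W o\<^sub>L T)) (inverse (norm x) *\<^sub>R x)) \<le> \<epsilon>"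
        using unit [OF that, of "inverse (norm x) *\<^sub>R x"] W(1) False
        by (simp add: blinfun.diff_left)
      then show ?thesis
        using False by (simp add: blinfun.scaleR_right field_simps)
    qed simp
  qed (use assms in simp)
  with W(1) show ?thesis by blast
qed


section \<open>Rank-one operators\<close>

lemma bounded_bilinear_scaleC:
  "bounded_bilinear (\<lambda>(c :: complex) (x :: 'a :: complex_normed_vector). c *\<^sub>C x)"
  by standard
    (auto simp: scaleC_add_left scaleC_add_right scaleR_scaleC [where ?'a = 'a] scaleC_scaleC norm_scaleC
      scaleR_conv_of_real mult.commute intro!: exI [of _ 1])

text \<open>The tensor \<open>u\<close> \<otimes> \<open>f\<close>. Domain and codomain are general
  so that the same construction serves on H and, with a functional on K(H) and a vector in K(H), on
  K(H) itself.\<close>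

definition rank_one :: "('a :: real_normed_vector \<Rightarrow>\<^sub>L complex) \<Rightarrow> 'b \<Rightarrow> 'a \<Rightarrow>\<^sub>L 'b :: complex_normed_vector"
  where "rank_one f u = Blinfun (\<lambda>x. blinfun_apply f x *\<^sub>C u)"

lemma rank_one_apply [simp]: "blinfun_apply (rank_one f u) x = blinfun_apply f x *\<^sub>C u"
  unfolding rank_one_def
  by (subst bounded_linear_Blinfun_apply,
      rule bounded_linear_compose [OF bounded_bilinear.bounded_linear_left [OF bounded_bilinear_scaleC]],
      rule blinfun.bounded_linear_right, rule refl)

lemma norm_rank_one_le: "norm (rank_one f u) \<le> norm f * norm u"
  using mult_right_mono [OF norm_blinfun [of f], of "norm u"]
  by (intro norm_blinfun_bound) (simp_all add: norm_scaleC mult_ac)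

lemma scaleC_complex [simp]: "c *\<^sub>C (z :: complex) = c * z"
  by (simp add: scaleC_complex_def)

text \<open>The unit ball is mapped into a compact disc in the complex line of
  \<open>u\<close>.\<close>

lemma rank_one_in_compact_ops:
  fixes f :: "'a :: complex_normed_vector \<Rightarrow>\<^sub>L complex"
  assumes "f \<in> bounded_ops"
  shows "rank_one f u \<in> compact_ops"
proof -
  have "compact ((\<lambda>c :: complex. c *\<^sub>C u) ` cball 0 (norm f))"
    by (intro compact_continuous_image bounded_linear.continuous_on [OF
          bounded_bilinear.bounded_linear_left [OF bounded_bilinear_scaleC]] continuous_intros
        compact_cball)
  moreover have "norm (blinfun_apply f x) \<le> norm f" if "norm x \<le> 1" for x
    using norm_blinfun [of f x] mult_left_mono [OF that, of "norm f"] by simp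
  then have "blinfun_apply (rank_one f u) ` cball 0 1 \<subseteq> (\<lambda>c. c *\<^sub>C u) ` cball 0 (norm f)"
    by auto
  ultimately have "compact (closure (blinfun_apply (rank_one f u) ` cball 0 1))"
    by (metis compact_closure_subset)
  then show ?thesis
    using assms by (simp add: compact_ops_def bounded_ops_def scaleC_scaleC)
qed

definition compact_rank_one :: "('h \<Rightarrow>\<^sub>L complex) \<Rightarrow> 'h \<Rightarrow> 'h :: complex_hilbert_space compact_op"
  where "compact_rank_one f u = Compact_op (rank_one f u)"

lemma op_of_compact_rank_one [simp]:
  "f \<in> bounded_ops \<Longrightarrow> op_of (compact_rank_one f u) = rank_one f u"
  by (simp add: compact_rank_one_def Compact_op_inverse rank_one_in_compact_ops)

lemma op_of_sum: "op_of (sum f A) = (\<Sum>i\<in>A. op_of (f i))"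
  by (induction A rule: infinite_finite_induct)
    (simp_all add: zero_compact_op.rep_eq plus_compact_op.rep_eq)

lemmas op_of_simps = zero_compact_op.rep_eq plus_compact_op.rep_eq minus_compact_op.rep_eq
  uminus_compact_op.rep_eq scaleC_compact_op.rep_eq scaleR_compact_op.rep_eq op_of_sum

lemmas blinfun_simps = blinfun.add_left blinfun.diff_left blinfun.minus_left blinfun.sum_left
  blinfun.zero_left blinfun.add_right blinfun.diff_right blinfun.minus_right blinfun.sum_right
  blinfun.zero_right

lemma op_of_in_bounded_ops [simp]: "op_of z \<in> bounded_ops"
  using op_of [of z] by (simp add: compact_ops_def)

lemma bounded_ops_scaleC: "f \<in> bounded_ops \<Longrightarrow> blinfun_apply f (c *\<^sub>C x) = c *\<^sub>C blinfun_apply f x"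
  by (simp add: bounded_ops_def)

lemma op_of_scaleC_right [simp]:
  "blinfun_apply (op_of z) (c *\<^sub>C x) = c *\<^sub>C blinfun_apply (op_of z) x"
  by (simp add: bounded_ops_scaleC)

lemma compact_op_eqI:
  "(\<And>x. blinfun_apply (op_of a) x = blinfun_apply (op_of b) x) \<Longrightarrow> a = b"
  by (metis blinfun_eqI op_of_inject)

lemma compact_op_map_eqI:
  fixes S T :: "'h :: complex_hilbert_space compact_op \<Rightarrow>\<^sub>L 'h compact_op"
  assumes "\<And>z x. blinfun_apply (op_of (blinfun_apply S z)) x = blinfun_apply (op_of (blinfun_apply T z)) x"
  shows "S = T"
  by (intro blinfun_eqI compact_op_eqI assms)

lemma bounded_ops_add: "S \<in> bounded_ops \<Longrightarrow> T \<in> bounded_ops \<Longrightarrow> S + T \<in> bounded_ops"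
  by (simp add: bounded_ops_def blinfun_simps scaleC_add_right)

lemma bounded_ops_diff: "S \<in> bounded_ops \<Longrightarrow> T \<in> bounded_ops \<Longrightarrow> S - T \<in> bounded_ops"
  by (simp add: bounded_ops_def blinfun_simps complex_vector.scale_right_diff_distrib)

lemma bounded_ops_scale: "T \<in> bounded_ops \<Longrightarrow> c *\<^sub>C T \<in> bounded_ops"
  by (simp add: bounded_ops_def scaleC_scaleC mult.commute)

definition inner_functional :: "'h :: complex_hilbert_space \<Rightarrow> 'h \<Rightarrow>\<^sub>L complex"
  where "inner_functional w = Blinfun (\<lambda>x. cinner x w)"

lemma inner_functional_apply [simp]: "blinfun_apply (inner_functional w) x = cinner x w"
  unfolding inner_functional_def
  by (subst bounded_linear_Blinfun_apply, rule bounded_linear_intro [where K = "norm w"])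
    (simp_all add: cinner_add_left scaleR_scaleC cinner_scaleC_left cmod_cinner_le)

lemma inner_functional_bounded_ops [simp]: "inner_functional w \<in> bounded_ops"
  by (simp add: bounded_ops_def cinner_scaleC_left)

text \<open>A generalized matrix entry of \<open>z\<close>. For x = u \<otimes> f and y = v
  \<otimes> g, the product x z y is the multiple of u \<otimes> g by this entry, so the elementary
  operator of x and y is \<open>rank_one (coefficient f v) (compact_rank_one g u)\<close>.\<close>

definition coefficient :: "('h \<Rightarrow>\<^sub>L complex) \<Rightarrow> 'h \<Rightarrow> 'h :: complex_hilbert_space compact_op \<Rightarrow>\<^sub>L complex"
  where "coefficient f v = Blinfun (\<lambda>z. blinfun_apply f (blinfun_apply (op_of z) v))"

lemma coefficient_bounded:
  "cmod (blinfun_apply f (blinfun_apply (op_of z) v)) \<le> norm z * (norm f * norm v)"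
proof -
  have "cmod (blinfun_apply f (blinfun_apply (op_of z) v)) \<le> norm f * norm (blinfun_apply (op_of z) v)"
    by (rule norm_blinfun)
  also have "\<dots> \<le> norm f * (norm (op_of z) * norm v)"
    by (intro mult_left_mono norm_blinfun) simp
  finally show ?thesis
    by (simp add: norm_compact_op.rep_eq mult_ac)
qed

lemma coefficient_apply [simp]:
  "blinfun_apply (coefficient f v) z = blinfun_apply f (blinfun_apply (op_of z) v)"
  unfolding coefficient_def
  by (subst bounded_linear_Blinfun_apply,
      rule bounded_linear_intro [where K = "norm f * norm v"])
    (simp_all add: op_of_simps blinfun_simps blinfun.scaleR_left blinfun.scaleR_right
      coefficient_bounded [unfolded mult.assoc [symmetric]] mult.assoc [symmetric])

lemma norm_coefficient_le: "norm (coefficient f v) \<le> norm f * norm v"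
  using coefficient_bounded by (intro norm_blinfun_bound) (simp_all add: mult_ac)


section \<open>Elementary operators\<close>

definition elementary :: "('h \<Rightarrow>\<^sub>L 'h) \<Rightarrow> ('h \<Rightarrow>\<^sub>L 'h)
    \<Rightarrow> 'h :: complex_hilbert_space compact_op \<Rightarrow>\<^sub>L 'h compact_op"
  where "elementary a b = left_mult a o\<^sub>L right_mult b"

lemma elementary_apply [simp]:
  assumes "a \<in> bounded_ops" "b \<in> bounded_ops"
  shows "blinfun_apply (op_of (blinfun_apply (elementary a b) z)) x
    = blinfun_apply a (blinfun_apply (op_of z) (blinfun_apply b x))"
  using assms by (simp add: elementary_def op_of_left_mult op_of_right_mult)

lemma inner_derivation_apply [simp]:
  "blinfun_apply (op_of (blinfun_apply (inner_derivation a) z)) x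
    = blinfun_apply (op_of a) (blinfun_apply (op_of z) x)
      - blinfun_apply (op_of z) (blinfun_apply (op_of a) x)"
  by (simp add: inner_derivation_def blinfun_simps op_of_simps op_of_left_mult op_of_right_mult)

section \<open>Closure properties of the algebra generated by the inner derivations\<close>

lemma subalgebra_D_Lie: "subalgebra (D_Lie :: ('h :: complex_hilbert_space compact_op \<Rightarrow>\<^sub>L 'h compact_op) set)"
  unfolding D_Lie_def by (rule hull_in) (auto simp: subalgebra_def)

lemma inner_derivation_in_D_Lie: "inner_derivation a \<in> D_Lie"
  unfolding D_Lie_def by (rule hull_inc) simp

lemma D_Lie_zero: "0 \<in> D_Lie"
  and D_Lie_add: "S \<in> D_Lie \<Longrightarrow> T \<in> D_Lie \<Longrightarrow> S + T \<in> D_Lie"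
  and D_Lie_scaleC: "T \<in> D_Lie \<Longrightarrow> c *\<^sub>C T \<in> D_Lie"
  and D_Lie_compose: "S \<in> D_Lie \<Longrightarrow> T \<in> D_Lie \<Longrightarrow> S o\<^sub>L T \<in> D_Lie"
  using subalgebra_D_Lie unfolding subalgebra_def by blast+

lemma D_Lie_diff: "S \<in> D_Lie \<Longrightarrow> T \<in> D_Lie \<Longrightarrow> S - T \<in> D_Lie"
  using D_Lie_add [OF _ D_Lie_scaleC [of T "-1"], of S] by simp

lemma D_Lie_sum: "(\<And>i. i \<in> A \<Longrightarrow> f i \<in> D_Lie) \<Longrightarrow> sum f A \<in> D_Lie"
  by (induction A rule: infinite_finite_induct) (simp_all add: D_Lie_zero D_Lie_add)

lemmas D_Lie_intros = D_Lie_add D_Lie_scaleC D_Lie_compose D_Lie_diff inner_derivation_in_D_Lie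

text \<open>For \<open>x = u \<otimes> f\<close> and \<open>y = v \<otimes> g\<close> the assumptions say \<open>x y = y x = 0\<close>, and the operator below is
  \<open>L\<^sub>x R\<^sub>y\<close>.\<close>

lemma rank_one_in_D_Lie_aux:
  fixes u v :: "'h :: complex_hilbert_space"
  assumes [simp]: "f \<in> bounded_ops" "g \<in> bounded_ops"
    and [simp]: "blinfun_apply f v = 0" "blinfun_apply g u = 0"
    and "blinfun_apply f u \<noteq> 0"
  shows "rank_one (coefficient f v) (compact_rank_one g u) \<in> D_Lie"
    and "rank_one (coefficient g u) (compact_rank_one f v) \<in> D_Lie"
proof -
  let ?X = "inner_derivation (compact_rank_one f u)"
  let ?Y = "inner_derivation (compact_rank_one g v)"
  let ?\<rho> = "blinfun_apply f u"
  let ?S = "rank_one (coefficient f v) (compact_rank_one g u)"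
  let ?T = "rank_one (coefficient g u) (compact_rank_one f v)"
  \<comment> \<open>\<open>?T\<close> is z \<mapsto> y z x. In the expansion of ad x (ad y z) the
    two terms containing xy or yx vanish.\<close>
  have XY: "?X o\<^sub>L ?Y = - ?S - ?T"
    by (intro compact_op_map_eqI)
      (simp add: op_of_simps blinfun_simps bounded_ops_scaleC scaleC_simps mult.commute)
  \<comment> \<open>Since x x = \<rho> x, a second ad x multiplies \<open>?S\<close> by \<rho> and
    \<open>?T\<close> by -\<rho>, which separates them.\<close>
  have XXY: "?X o\<^sub>L (?X o\<^sub>L ?Y) = ?\<rho> *\<^sub>C ?T - ?\<rho> *\<^sub>C ?S"
    unfolding XY by (intro compact_op_map_eqI)
      (simp add: op_of_simps blinfun_simps bounded_ops_scaleC scaleC_simps mult.commute mult.left_commute)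
  \<comment> \<open>The two relations are a linear system for \<open>?S\<close> and
    \<open>?T\<close>, solvable because \<rho> is nonzero; combining them isolates twice \<rho>
    \<open>?S\<close> and twice \<rho> \<open>?T\<close>.\<close>
  have half: "S = (1 / (2 * ?\<rho>)) *\<^sub>C (?\<rho> *\<^sub>C S + ?\<rho> *\<^sub>C S)" for S :: "'h compact_op \<Rightarrow>\<^sub>L 'h compact_op"
    using assms(5) by (simp add: scaleC_scaleC flip: scaleC_add_left)
  have "?\<rho> *\<^sub>C ?S + ?\<rho> *\<^sub>C ?S = (-1) *\<^sub>C ((?X o\<^sub>L (?X o\<^sub>L ?Y)) + ?\<rho> *\<^sub>C (?X o\<^sub>L ?Y))"
    unfolding XXY unfolding XY by (simp add: scaleC_simps)
  then have "?\<rho> *\<^sub>C ?S + ?\<rho> *\<^sub>C ?S \<in> D_Lie"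
    by (simp only:) (intro D_Lie_intros)
  then show "?S \<in> D_Lie"
    by (subst half) (rule D_Lie_scaleC)
  have "?\<rho> *\<^sub>C ?T + ?\<rho> *\<^sub>C ?T = (?X o\<^sub>L (?X o\<^sub>L ?Y)) - ?\<rho> *\<^sub>C (?X o\<^sub>L ?Y)"
    unfolding XXY unfolding XY by (simp add: scaleC_simps)
  then have "?\<rho> *\<^sub>C ?T + ?\<rho> *\<^sub>C ?T \<in> D_Lie"
    by (simp only:) (intro D_Lie_intros)
  then show "?T \<in> D_Lie"
    by (subst half) (rule D_Lie_scaleC)
qed


section \<open>Bilinearity of rank-one operators\<close>

lemma rank_one_add_left: "rank_one (f + g) u = rank_one f u + rank_one g u"
  and rank_one_diff_left: "rank_one (f - g) u = rank_one f u - rank_one g u"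
  and rank_one_scaleC_left: "rank_one (c *\<^sub>C f) u = c *\<^sub>C rank_one f u"
  and rank_one_add_right: "rank_one f (u + v) = rank_one f u + rank_one f v"
  and rank_one_diff_right: "rank_one f (u - v) = rank_one f u - rank_one f v"
  and rank_one_scaleC_right: "rank_one f (c *\<^sub>C u) = c *\<^sub>C rank_one f u"
  by (rule blinfun_eqI; simp add: blinfun_simps scaleC_simps mult.commute)+

lemma rank_one_zero_left [simp]: "rank_one 0 u = 0"
  and rank_one_zero_right [simp]: "rank_one f 0 = 0"
  by (rule blinfun_eqI; simp)+

lemma rank_one_sum_left: "rank_one (sum f A) u = (\<Sum>i\<in>A. rank_one (f i) u)"
  by (induction A rule: infinite_finite_induct) (simp_all add: rank_one_add_left)

lemma rank_one_sum_right: "rank_one f (sum u A) = (\<Sum>i\<in>A. rank_one f (u i))"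
  by (induction A rule: infinite_finite_induct) (simp_all add: rank_one_add_right)

lemmas rank_one_simps = rank_one_add_left rank_one_diff_left rank_one_scaleC_left
  rank_one_add_right rank_one_diff_right rank_one_scaleC_right rank_one_sum_left rank_one_sum_right

lemma compact_rank_one_diff_left:
  "f \<in> bounded_ops \<Longrightarrow> g \<in> bounded_ops \<Longrightarrow>
    compact_rank_one (f - g) u = compact_rank_one f u - compact_rank_one g u"
  by (rule compact_op_eqI) (simp add: bounded_ops_diff op_of_simps blinfun_simps scaleC_simps)

lemma coefficient_diff_right: "coefficient f (v - w) = coefficient f v - coefficient f w"
  by (rule blinfun_eqI) (simp add: blinfun_simps)

text \<open>Removes the condition that \<open>f u\<close> is nonzero. If \<open>f u\<close> and
  \<open>g v\<close> both vanish, there are three cases. If \<open>v\<close> is not a multiple of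
  \<open>u\<close>, then \<open>g\<close> is a difference of two functionals that kill
  \<open>u\<close> but not \<open>v\<close>. If some \<open>w\<close> is killed by \<open>f\<close>
  but not by \<open>g\<close>, then \<open>v\<close> is the difference of \<open>v + w\<close> and
  \<open>w\<close>. Otherwise y is a multiple of x, where x x = 0, and ad x applied twice is z
  \<mapsto> -2 x z x.\<close>

lemma rank_one_in_D_Lie:
  fixes u v :: "'h :: complex_hilbert_space"
  assumes f: "f \<in> bounded_ops" and g: "g \<in> bounded_ops"
    and fv: "blinfun_apply f v = 0" and gu: "blinfun_apply g u = 0"
  shows "rank_one (coefficient f v) (compact_rank_one g u) \<in> D_Lie"
proof -
  consider "blinfun_apply f u \<noteq> 0" | "blinfun_apply g v \<noteq> 0"
    | (vec) "blinfun_apply g v = 0" "proj (if u = 0 then {} else {inverse (norm u) *\<^sub>R u}) v \<noteq> v"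
    | (fnl) w where "blinfun_apply g v = 0" "blinfun_apply f w = 0" "blinfun_apply g w \<noteq> 0"
    | (par) "blinfun_apply f u = 0" "proj (if u = 0 then {} else {inverse (norm u) *\<^sub>R u}) v = v"
        "\<And>w. blinfun_apply f w = 0 \<Longrightarrow> blinfun_apply g w = 0"
    by blast
  then show ?thesis
  proof cases
    case 1
    then show ?thesis by (rule rank_one_in_D_Lie_aux(1) [OF f g fv gu])
  next
    case 2
    then show ?thesis by (rule rank_one_in_D_Lie_aux(2) [OF g f gu fv])
  next
    case vec
    define W where "W = (if u = 0 then {} else {inverse (norm u) *\<^sub>R u})"
    have W: "orthonormal W"
      by (simp add: W_def orthonormal_empty orthonormal_singleton)
    have Wu: "proj W u = u"
      by (simp add: W_def proj_def scaleR_scaleC cinner_scaleC_right scaleC_scaleC cinner_self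
          power2_eq_square mult.commute mult.left_commute)
    \<comment> \<open>Pairing with the component of \<open>v\<close> orthogonal to \<open>u\<close>
      kills \<open>u\<close> and is nonzero at \<open>v\<close>.\<close>
    define k where "k = inner_functional (v - proj W v)"
    have orth: "cinner a (v - proj W v) = 0" if "proj W a = a" for a
    proof -
      have "cinner (v - proj W v) (proj W a) = 0"
        by (subst (2) proj_def)
          (simp add: cinner_sum_right cinner_scaleC_right cinner_diff_left cinner_proj W)
      then show ?thesis using that by (subst cinner_commute) simp
    qed
    have ku: "blinfun_apply k u = 0"
      using orth [OF Wu] by (simp add: k_def)
    have "blinfun_apply k v = cinner (v - proj W v) (v - proj W v)"
      using orth [OF proj_proj [OF W, of v]] by (simp add: k_def cinner_diff_left)
    then have kv: "blinfun_apply k v \<noteq> 0"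
      using vec(2) by (simp add: cinner_self W_def)
    have k: "k \<in> bounded_ops" by (simp add: k_def)
    have "rank_one (coefficient f v) (compact_rank_one (g + k) u) \<in> D_Lie"
      using rank_one_in_D_Lie_aux(2) [OF bounded_ops_add [OF g k] f _ fv] vec(1) kv ku gu
      by (simp add: blinfun_simps)
    moreover have "rank_one (coefficient f v) (compact_rank_one k u) \<in> D_Lie"
      using rank_one_in_D_Lie_aux(2) [OF k f ku fv] kv by simp
    ultimately have "rank_one (coefficient f v) (compact_rank_one (g + k) u - compact_rank_one k u) \<in> D_Lie"
      by (simp add: rank_one_simps D_Lie_diff)
    then show ?thesis
      using compact_rank_one_diff_left [OF bounded_ops_add [OF g k] k] by simp
  next
    case fnl
    have "rank_one (coefficient f (v + w)) (compact_rank_one g u) \<in> D_Lie"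
      using rank_one_in_D_Lie_aux(2) [OF g f gu, of "v + w"] fnl fv by (simp add: blinfun_simps)
    moreover have "rank_one (coefficient f w) (compact_rank_one g u) \<in> D_Lie"
      using rank_one_in_D_Lie_aux(2) [OF g f gu, of w] fnl by simp
    ultimately have "rank_one (coefficient f (v + w) - coefficient f w) (compact_rank_one g u) \<in> D_Lie"
      by (simp add: rank_one_simps D_Lie_diff)
    then show ?thesis
      using coefficient_diff_right [of f "v + w" w] by simp
  next
    case par
    obtain c where c: "v = c *\<^sub>C u"
      using par(2) by (auto simp: proj_def scaleR_scaleC scaleC_scaleC split: if_splits)
        (metis complex_vector.scale_zero_left)
    obtain d where d: "\<And>x. blinfun_apply g x = d * blinfun_apply f x"
    proof (cases "f = 0")
      case True
      then show ?thesis using par(3) that [of 0] by simp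
    next
      case False
      then obtain a where a: "blinfun_apply f a \<noteq> 0" by (metis blinfun_eqI blinfun.zero_left)
      \<comment> \<open>Correcting \<open>x\<close> by a multiple of \<open>a\<close> moves it into
        the kernel of \<open>f\<close>, hence into that of \<open>g\<close>.\<close>
      have "blinfun_apply g x = (blinfun_apply g a / blinfun_apply f a) * blinfun_apply f x" for x
      proof -
        have "blinfun_apply f (x - (blinfun_apply f x / blinfun_apply f a) *\<^sub>C a) = 0"
          using a by (simp add: blinfun_simps bounded_ops_scaleC f)
        from par(3) [OF this] show ?thesis
          using a by (simp add: blinfun_simps bounded_ops_scaleC g)
      qed
      then show ?thesis by (rule that)
    qed
    let ?X = "inner_derivation (compact_rank_one f u)"
    let ?S = "rank_one (coefficient f v) (compact_rank_one g u)"
    have "?S = (- c * d / 2) *\<^sub>C (?X o\<^sub>L ?X)"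
      using par(1) f g
      by (intro compact_op_map_eqI)
        (simp add: op_of_simps blinfun_simps bounded_ops_scaleC scaleC_simps c d
          mult.commute mult.left_commute flip: scaleC_add_left)
    then show ?thesis by (simp only:) (intro D_Lie_intros)
  qed
qed

text \<open>With \<open>u\<^sub>0 = u - h(u) w\<close> and \<open>g\<^sub>0 = g - g(w) h\<close> one has
  \<open>g \<otimes> u - g(u) h \<otimes> w = (g\<^sub>0 - h) \<otimes> (u\<^sub>0 + g\<^sub>0(u\<^sub>0) w) + (1 + g(w)) h \<otimes> u\<^sub>0 + (h(u) - g\<^sub>0(u\<^sub>0)) g\<^sub>0 \<otimes> w\<close>,
  a combination of three rank-one operators of square zero.\<close>

lemma rank_one_traceless_decomp:
  assumes "g \<in> bounded_ops" "h \<in> bounded_ops" "blinfun_apply h w = 1"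
  obtains g\<^sub>0 u\<^sub>0 u\<^sub>1 a b where "g\<^sub>0 \<in> bounded_ops" "blinfun_apply (g\<^sub>0 - h) u\<^sub>1 = 0"
    "blinfun_apply h u\<^sub>0 = 0" "blinfun_apply g\<^sub>0 w = 0"
    "compact_rank_one g u - blinfun_apply g u *\<^sub>C compact_rank_one h w
      = compact_rank_one (g\<^sub>0 - h) u\<^sub>1 + a *\<^sub>C compact_rank_one h u\<^sub>0 + b *\<^sub>C compact_rank_one g\<^sub>0 w"
    "coefficient g u - blinfun_apply g u *\<^sub>C coefficient h w
      = coefficient (g\<^sub>0 - h) u\<^sub>1 + a *\<^sub>C coefficient h u\<^sub>0 + b *\<^sub>C coefficient g\<^sub>0 w"
proof -
  define g\<^sub>0 where "g\<^sub>0 = g - blinfun_apply g w *\<^sub>C h"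
  define u\<^sub>0 where "u\<^sub>0 = u - blinfun_apply h u *\<^sub>C w"
  define u\<^sub>1 where "u\<^sub>1 = u\<^sub>0 + blinfun_apply g\<^sub>0 u\<^sub>0 *\<^sub>C w"
  have g0: "g\<^sub>0 \<in> bounded_ops"
    using assms by (simp add: g\<^sub>0_def bounded_ops_diff bounded_ops_scale)
  have g0w: "blinfun_apply g\<^sub>0 w = 0" and hu0: "blinfun_apply h u\<^sub>0 = 0"
    and gu: "blinfun_apply g u = blinfun_apply g\<^sub>0 u\<^sub>0 + blinfun_apply h u * blinfun_apply g w"
    using assms by (simp_all add: g\<^sub>0_def u\<^sub>0_def blinfun_simps bounded_ops_scaleC)
  have g: "g = g\<^sub>0 + blinfun_apply g w *\<^sub>C h" and u: "u = u\<^sub>0 + blinfun_apply h u *\<^sub>C w"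
    by (simp_all add: g\<^sub>0_def u\<^sub>0_def)
  define \<alpha> \<beta> \<gamma> where "\<alpha> = blinfun_apply g w" and "\<beta> = blinfun_apply h u" and "\<gamma> = blinfun_apply g\<^sub>0 u\<^sub>0"
  note abbr = \<alpha>_def [symmetric] \<beta>_def [symmetric] \<gamma>_def [symmetric]
  have g': "blinfun_apply g x = blinfun_apply g\<^sub>0 x + \<alpha> * blinfun_apply h x" for x
    by (subst g) (simp add: blinfun_simps \<alpha>_def)
  show ?thesis
  proof (rule that [of g\<^sub>0 u\<^sub>1 u\<^sub>0 "1 + \<alpha>" "\<beta> - \<gamma>"])
    show "blinfun_apply (g\<^sub>0 - h) u\<^sub>1 = 0"
      using g0w hu0 assms g0 by (simp add: u\<^sub>1_def blinfun_simps bounded_ops_scaleC)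
    show "compact_rank_one g u - blinfun_apply g u *\<^sub>C compact_rank_one h w
      = compact_rank_one (g\<^sub>0 - h) u\<^sub>1 + (1 + \<alpha>) *\<^sub>C compact_rank_one h u\<^sub>0
        + (\<beta> - \<gamma>) *\<^sub>C compact_rank_one g\<^sub>0 w"
    proof (rule compact_op_eqI)
      fix x
      define G H where "G = blinfun_apply g\<^sub>0 x" and "H = blinfun_apply h x"
      have "(G + \<alpha> * H) *\<^sub>C (u\<^sub>0 + \<beta> *\<^sub>C w) - ((\<gamma> + \<beta> * \<alpha>) * H) *\<^sub>C w
        = (G - H) *\<^sub>C (u\<^sub>0 + \<gamma> *\<^sub>C w) + ((1 + \<alpha>) * H) *\<^sub>C u\<^sub>0 + ((\<beta> - \<gamma>) * G) *\<^sub>C w"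
        by (simp add: scaleC_simps algebra_simps)
      then show "blinfun_apply (op_of (compact_rank_one g u - blinfun_apply g u *\<^sub>C compact_rank_one h w)) x
        = blinfun_apply (op_of (compact_rank_one (g\<^sub>0 - h) u\<^sub>1 + (1 + \<alpha>) *\<^sub>C compact_rank_one h u\<^sub>0
          + (\<beta> - \<gamma>) *\<^sub>C compact_rank_one g\<^sub>0 w)) x"
        using assms g0
        by (simp add: op_of_simps blinfun_simps bounded_ops_diff g' [of x] gu u\<^sub>1_def scaleC_scaleC
            flip: u \<alpha>_def \<beta>_def \<gamma>_def G_def H_def) (simp add: u [folded \<beta>_def])
    qed
    \<comment> \<open>Like \<open>compact_rank_one\<close>, \<open>coefficient\<close> is bilinear
      in the functional and the vector, so the same decomposition applies.\<close>
    show "coefficient g u - blinfun_apply g u *\<^sub>C coefficient h w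
      = coefficient (g\<^sub>0 - h) u\<^sub>1 + (1 + \<alpha>) *\<^sub>C coefficient h u\<^sub>0 + (\<beta> - \<gamma>) *\<^sub>C coefficient g\<^sub>0 w"
    proof (rule blinfun_eqI)
      fix z :: "'a compact_op"
      have z: "blinfun_apply (op_of z) u = blinfun_apply (op_of z) u\<^sub>0 + \<beta> *\<^sub>C blinfun_apply (op_of z) w"
        by (subst u) (simp add: blinfun_simps \<beta>_def)
      show "blinfun_apply (coefficient g u - blinfun_apply g u *\<^sub>C coefficient h w) z
        = blinfun_apply (coefficient (g\<^sub>0 - h) u\<^sub>1 + (1 + \<alpha>) *\<^sub>C coefficient h u\<^sub>0
          + (\<beta> - \<gamma>) *\<^sub>C coefficient g\<^sub>0 w) z"
        using assms(2) g0 unfolding gu abbr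
        by (simp add: blinfun_simps g' z u\<^sub>1_def bounded_ops_scaleC algebra_simps flip: \<gamma>_def)
    qed
  qed (use g0 hu0 g0w in auto)
qed


section \<open>Compression to trace zero\<close>

text \<open>The trace of the compression to the span of \<open>W\<close>, divided by the dimension.
  Its norm stays bounded by 1 as \<open>W\<close> grows, whereas that of
  \<open>normalized_proj\<close>, which has trace 1 for nonempty \<open>W\<close>, decays; the final
  estimate rests on this asymmetry.\<close>

definition normalized_trace :: "'h set \<Rightarrow> 'h :: complex_hilbert_space compact_op \<Rightarrow>\<^sub>L complex"
  where "normalized_trace W = (1 / of_nat (card W)) *\<^sub>C (\<Sum>w\<in>W. coefficient (inner_functional w) w)"

definition normalized_proj :: "'h set \<Rightarrow> 'h :: complex_hilbert_space compact_op"
  where "normalized_proj W = (1 / of_nat (card W)) *\<^sub>C (\<Sum>w\<in>W. compact_rank_one (inner_functional w) w)"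

text \<open>Reduces a correction by an average over \<open>W\<close> to corrections by its single
  members.\<close>

lemma scaleC_average:
  fixes \<phi> :: "'i \<Rightarrow> 'a :: complex_normed_vector"
  assumes "finite W" "W \<noteq> {}"
  shows "b - c *\<^sub>C ((1 / of_nat (card W)) *\<^sub>C (\<Sum>w\<in>W. \<phi> w))
    = (1 / of_nat (card W)) *\<^sub>C (\<Sum>w\<in>W. b - c *\<^sub>C \<phi> w)"
proof -
  have const: "(\<Sum>w\<in>W. b) = of_nat (card W) *\<^sub>C b"
    using assms(1) by (induction W rule: finite_induct) (simp_all add: scaleC_add_left)
  show ?thesis
    using assms unfolding sum_subtractf const
    by (simp add: scaleC_simps complex_vector.scale_sum_right mult.commute)
qed

text \<open>For each \<open>w\<close> in \<open>W\<close> the difference of \<open>g\<close>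
  \<otimes> \<open>u\<close> and the multiple of the projection onto \<open>w\<close> has trace
  zero. \<open>rank_one_traceless_decomp\<close> splits it into square-zero rank-one operators, to
  which the hypothesis on \<open>\<phi>\<close> applies; then average over \<open>W\<close>.\<close>

lemma rank_one_right_normalized_in_D_Lie:
  assumes W: "orthonormal W" "W \<noteq> {}" and g: "g \<in> bounded_ops"
    and \<phi>: "\<And>g u. g \<in> bounded_ops \<Longrightarrow> blinfun_apply g u = 0 \<Longrightarrow> rank_one \<phi> (compact_rank_one g u) \<in> D_Lie"
  shows "rank_one \<phi> (compact_rank_one g u - blinfun_apply g u *\<^sub>C normalized_proj W) \<in> D_Lie"
proof -
  have "rank_one \<phi> (compact_rank_one g u
      - blinfun_apply g u *\<^sub>C compact_rank_one (inner_functional w) w) \<in> D_Lie" if "w \<in> W" for w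
  proof -
    have w: "blinfun_apply (inner_functional w) w = 1"
      using W(1) that by (simp add: orthonormal_def)
    show ?thesis
    proof (rule rank_one_traceless_decomp [OF g inner_functional_bounded_ops w, of u])
      fix g\<^sub>0 u\<^sub>0 u\<^sub>1 a b
      assume "g\<^sub>0 \<in> bounded_ops" "blinfun_apply (g\<^sub>0 - inner_functional w) u\<^sub>1 = 0"
        "blinfun_apply (inner_functional w) u\<^sub>0 = 0" "blinfun_apply g\<^sub>0 w = 0"
        "compact_rank_one g u - blinfun_apply g u *\<^sub>C compact_rank_one (inner_functional w) w
          = compact_rank_one (g\<^sub>0 - inner_functional w) u\<^sub>1
            + a *\<^sub>C compact_rank_one (inner_functional w) u\<^sub>0 + b *\<^sub>C compact_rank_one g\<^sub>0 w"
      then show ?thesis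
        by (simp only: rank_one_add_right rank_one_scaleC_right)
          (intro D_Lie_intros \<phi> bounded_ops_diff inner_functional_bounded_ops)
    qed
  qed
  then show ?thesis
    using W unfolding normalized_proj_def orthonormal_def
    by (subst scaleC_average) (auto simp: rank_one_scaleC_right rank_one_sum_right
        intro!: D_Lie_scaleC D_Lie_sum)
qed

text \<open>The dual argument, with the vector \<open>A\<close> held fixed and the functional
  decomposed.\<close>

lemma rank_one_left_normalized_in_D_Lie:
  assumes W: "orthonormal W" "W \<noteq> {}" and f: "f \<in> bounded_ops"
    and A: "\<And>f v. f \<in> bounded_ops \<Longrightarrow> blinfun_apply f v = 0 \<Longrightarrow> rank_one (coefficient f v) A \<in> D_Lie"
  shows "rank_one (coefficient f v - blinfun_apply f v *\<^sub>C normalized_trace W) A \<in> D_Lie"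
proof -
  have "rank_one (coefficient f v
      - blinfun_apply f v *\<^sub>C coefficient (inner_functional w) w) A \<in> D_Lie" if "w \<in> W" for w
  proof -
    have w: "blinfun_apply (inner_functional w) w = 1"
      using W(1) that by (simp add: orthonormal_def)
    show ?thesis
    proof (rule rank_one_traceless_decomp [OF f inner_functional_bounded_ops w, of v])
      fix g\<^sub>0 u\<^sub>0 u\<^sub>1 a b
      assume "g\<^sub>0 \<in> bounded_ops" "blinfun_apply (g\<^sub>0 - inner_functional w) u\<^sub>1 = 0"
        "blinfun_apply (inner_functional w) u\<^sub>0 = 0" "blinfun_apply g\<^sub>0 w = 0"
        "coefficient f v - blinfun_apply f v *\<^sub>C coefficient (inner_functional w) w
          = coefficient (g\<^sub>0 - inner_functional w) u\<^sub>1
            + a *\<^sub>C coefficient (inner_functional w) u\<^sub>0 + b *\<^sub>C coefficient g\<^sub>0 w"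
      then show ?thesis
        by (simp only: rank_one_add_left rank_one_scaleC_left)
          (intro D_Lie_intros A bounded_ops_diff inner_functional_bounded_ops)
    qed
  qed
  then show ?thesis
    using W unfolding normalized_trace_def orthonormal_def
    by (subst scaleC_average) (auto simp: rank_one_scaleC_left rank_one_sum_left
        intro!: D_Lie_scaleC D_Lie_sum)
qed

text \<open>The two corrections are made one after the other: the right one supplies the hypothesis
  of the left one.\<close>

lemma rank_one_normalized_in_D_Lie:
  assumes W: "orthonormal W" "W \<noteq> {}" and f: "f \<in> bounded_ops" and g: "g \<in> bounded_ops"
  shows "rank_one (coefficient f v - blinfun_apply f v *\<^sub>C normalized_trace W)
    (compact_rank_one g u - blinfun_apply g u *\<^sub>C normalized_proj W) \<in> D_Lie"
proof (rule rank_one_left_normalized_in_D_Lie [OF W f])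
  fix f' :: "'a \<Rightarrow>\<^sub>L complex" and v' assume "f' \<in> bounded_ops" "blinfun_apply f' v' = 0"
  then show "rank_one (coefficient f' v')
      (compact_rank_one g u - blinfun_apply g u *\<^sub>C normalized_proj W) \<in> D_Lie"
    using rank_one_right_normalized_in_D_Lie [OF W g rank_one_in_D_Lie] by blast
qed

section \<open>Products, traces and the expansion of finite-rank coefficients\<close>

definition compact_mult :: "'h compact_op \<Rightarrow> 'h compact_op \<Rightarrow> 'h :: complex_hilbert_space compact_op"
  where "compact_mult x y = blinfun_apply (left_mult (op_of x)) y"

lemma op_of_compact_mult: "op_of (compact_mult x y) = op_of x o\<^sub>L op_of y"
  by (simp add: compact_mult_def op_of_left_mult)

definition fin_trace :: "'h :: complex_hilbert_space set \<Rightarrow> ('h \<Rightarrow>\<^sub>L 'h) \<Rightarrow> complex"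
  where "fin_trace V a = (\<Sum>v\<in>V. cinner (blinfun_apply a v) v)"

definition trace_functional :: "'h set \<Rightarrow> ('h \<Rightarrow>\<^sub>L 'h) \<Rightarrow> 'h :: complex_hilbert_space compact_op \<Rightarrow>\<^sub>L complex"
  where "trace_functional V a = (\<Sum>v\<in>V. coefficient (inner_functional v o\<^sub>L a) v)"

lemma trace_functional_apply:
  "blinfun_apply (trace_functional V a) z = fin_trace V (a o\<^sub>L op_of z)"
  by (simp add: trace_functional_def fin_trace_def blinfun_simps)

lemma fin_trace_sum: "fin_trace V (sum a I) = (\<Sum>i\<in>I. fin_trace V (a i))"
  unfolding fin_trace_def blinfun.sum_left cinner_sum_left by (rule sum.swap)

lemma trace_functional_sum: "trace_functional V (sum a I) = (\<Sum>i\<in>I. trace_functional V (a i))"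
proof (rule blinfun_eqI)
  fix z
  have "sum a I o\<^sub>L op_of z = (\<Sum>i\<in>I. a i o\<^sub>L op_of z)"
    by (rule blinfun_eqI) (simp add: blinfun_simps)
  then show "blinfun_apply (trace_functional V (sum a I)) z
      = blinfun_apply (\<Sum>i\<in>I. trace_functional V (a i)) z"
    by (simp add: trace_functional_apply fin_trace_sum blinfun_simps)
qed

text \<open>Expand \<open>x\<close> and \<open>y\<close> along the basis \<open>V\<close> of a space
  containing their ranges, apply \<open>rank_one_normalized_in_D_Lie\<close> to every pair of basis
  vectors and multiply out. The pure terms give the elementary operator; the mixed terms collect to
  the product xy, the functional z \<mapsto> tr(y x z) and the scalar tr(xy).\<close>

lemma elementary_normalized_in_D_Lie:
  fixes x y :: "'h :: complex_hilbert_space compact_op"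
  assumes V: "orthonormal V"
    and x: "\<And>a. proj V (blinfun_apply (op_of x) a) = blinfun_apply (op_of x) a"
    and y: "\<And>a. proj V (blinfun_apply (op_of y) a) = blinfun_apply (op_of y) a"
    and W: "orthonormal W" "W \<noteq> {}"
  shows "elementary (op_of x) (op_of y) - rank_one (normalized_trace W) (compact_mult x y)
    - rank_one (trace_functional V (op_of y o\<^sub>L op_of x)) (normalized_proj W)
    + fin_trace V (op_of x o\<^sub>L op_of y) *\<^sub>C rank_one (normalized_trace W) (normalized_proj W) \<in> D_Lie"
proof -
  define f where "f v = inner_functional v o\<^sub>L op_of x" for v
  define g where "g v = inner_functional v o\<^sub>L op_of y" for v
  have f [simp]: "f v \<in> bounded_ops" and g [simp]: "g v \<in> bounded_ops" for v
    by (simp_all add: f_def g_def bounded_ops_compose)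
  have fa: "blinfun_apply (f v) a = cinner (blinfun_apply (op_of x) a) v"
    and ga: "blinfun_apply (g v) a = cinner (blinfun_apply (op_of y) a) v" for v a
    by (simp_all add: f_def g_def)
  have xa: "blinfun_apply (op_of x) a = (\<Sum>v\<in>V. blinfun_apply (f v) a *\<^sub>C v)" for a
    unfolding fa using x [of a] by (simp add: proj_def)
  have ya: "blinfun_apply (op_of y) a = (\<Sum>v\<in>V. blinfun_apply (g v) a *\<^sub>C v)" for a
    unfolding ga using y [of a] by (simp add: proj_def)
  let ?\<tau> = "normalized_trace W" and ?q = "normalized_proj W"
  have "(\<Sum>v\<in>V. \<Sum>w\<in>V. rank_one (coefficient (f v) w - blinfun_apply (f v) w *\<^sub>C ?\<tau>)
      (compact_rank_one (g w) v - blinfun_apply (g w) v *\<^sub>C ?q)) \<in> D_Lie"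
    by (intro D_Lie_sum rank_one_normalized_in_D_Lie W f g)
  also have "(\<Sum>v\<in>V. \<Sum>w\<in>V. rank_one (coefficient (f v) w - blinfun_apply (f v) w *\<^sub>C ?\<tau>)
        (compact_rank_one (g w) v - blinfun_apply (g w) v *\<^sub>C ?q))
      = (\<Sum>v\<in>V. \<Sum>w\<in>V. rank_one (coefficient (f v) w) (compact_rank_one (g w) v))
        - rank_one ?\<tau> (\<Sum>v\<in>V. \<Sum>w\<in>V. blinfun_apply (f v) w *\<^sub>C compact_rank_one (g w) v)
        - rank_one (\<Sum>v\<in>V. \<Sum>w\<in>V. blinfun_apply (g w) v *\<^sub>C coefficient (f v) w) ?q
        + (\<Sum>v\<in>V. \<Sum>w\<in>V. blinfun_apply (f v) w * blinfun_apply (g w) v) *\<^sub>C rank_one ?\<tau> ?q"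
    by (simp add: rank_one_simps scaleC_simps complex_vector.scale_sum_left sum.distrib sum_subtractf
        algebra_simps)
  also have "(\<Sum>v\<in>V. \<Sum>w\<in>V. rank_one (coefficient (f v) w) (compact_rank_one (g w) v))
      = elementary (op_of x) (op_of y)"
  proof (rule compact_op_map_eqI)
    fix z a
    have "blinfun_apply (op_of x) (blinfun_apply (op_of z) (blinfun_apply (op_of y) a))
        = (\<Sum>v\<in>V. \<Sum>w\<in>V. (blinfun_apply (f v) (blinfun_apply (op_of z) w) * blinfun_apply (g w) a) *\<^sub>C v)"
      by (subst xa, subst ya)
        (simp add: blinfun_simps bounded_ops_scaleC [OF f] complex_vector.scale_sum_left mult.commute)
    then show "blinfun_apply (op_of (blinfun_apply
          (\<Sum>v\<in>V. \<Sum>w\<in>V. rank_one (coefficient (f v) w) (compact_rank_one (g w) v)) z)) a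
        = blinfun_apply (op_of (blinfun_apply (elementary (op_of x) (op_of y)) z)) a"
      by (simp add: blinfun_simps op_of_simps scaleC_scaleC)
  qed
  also have "(\<Sum>v\<in>V. \<Sum>w\<in>V. blinfun_apply (f v) w *\<^sub>C compact_rank_one (g w) v) = compact_mult x y"
  proof (rule compact_op_eqI)
    fix a
    show "blinfun_apply (op_of (\<Sum>v\<in>V. \<Sum>w\<in>V. blinfun_apply (f v) w *\<^sub>C compact_rank_one (g w) v)) a
      = blinfun_apply (op_of (compact_mult x y)) a"
      by (simp add: op_of_compact_mult, subst xa, subst ya)
        (simp add: blinfun_simps op_of_simps bounded_ops_scaleC [OF f] complex_vector.scale_sum_left
          scaleC_scaleC mult.commute)
  qed
  also have "(\<Sum>v\<in>V. \<Sum>w\<in>V. blinfun_apply (g w) v *\<^sub>C coefficient (f v) w)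
      = trace_functional V (op_of y o\<^sub>L op_of x)"
  proof (rule blinfun_eqI)
    fix z
    have "cinner (blinfun_apply (op_of y) (blinfun_apply (op_of x) (blinfun_apply (op_of z) w))) w
        = (\<Sum>v\<in>V. blinfun_apply (g w) v * blinfun_apply (f v) (blinfun_apply (op_of z) w))" for w
      by (subst xa) (simp add: blinfun_simps cinner_sum_left cinner_scaleC_left ga mult.commute)
    then show "blinfun_apply (\<Sum>v\<in>V. \<Sum>w\<in>V. blinfun_apply (g w) v *\<^sub>C coefficient (f v) w) z
        = blinfun_apply (trace_functional V (op_of y o\<^sub>L op_of x)) z"
      by (simp add: trace_functional_apply fin_trace_def blinfun_simps) (rule sum.swap)
  qed
  also have "(\<Sum>v\<in>V. \<Sum>w\<in>V. blinfun_apply (f v) w * blinfun_apply (g w) v)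
      = fin_trace V (op_of x o\<^sub>L op_of y)"
  proof -
    have "cinner (blinfun_apply (op_of x) (blinfun_apply (op_of y) v)) v
        = (\<Sum>w\<in>V. blinfun_apply (f v) w * blinfun_apply (g w) v)" for v
      by (subst ya) (simp add: blinfun_simps cinner_sum_left cinner_scaleC_left fa mult.commute)
    then show ?thesis by (simp add: fin_trace_def)
  qed
  finally show ?thesis .
qed

lemma sum_elementary_normalized_in_D_Lie:
  fixes x y :: "'i \<Rightarrow> 'h :: complex_hilbert_space compact_op"
  assumes V: "orthonormal V"
    and x: "\<And>i a. i \<in> I \<Longrightarrow> proj V (blinfun_apply (op_of (x i)) a) = blinfun_apply (op_of (x i)) a"
    and y: "\<And>i a. i \<in> I \<Longrightarrow> proj V (blinfun_apply (op_of (y i)) a) = blinfun_apply (op_of (y i)) a"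
    and W: "orthonormal W" "W \<noteq> {}"
  shows "(\<Sum>i\<in>I. elementary (op_of (x i)) (op_of (y i)))
    - rank_one (normalized_trace W) (\<Sum>i\<in>I. compact_mult (x i) (y i))
    - rank_one (trace_functional V (\<Sum>i\<in>I. op_of (y i) o\<^sub>L op_of (x i))) (normalized_proj W)
    + fin_trace V (\<Sum>i\<in>I. op_of (x i) o\<^sub>L op_of (y i)) *\<^sub>C rank_one (normalized_trace W) (normalized_proj W)
    \<in> D_Lie"
proof -
  have "(\<Sum>i\<in>I. elementary (op_of (x i)) (op_of (y i))
    - rank_one (normalized_trace W) (compact_mult (x i) (y i))
    - rank_one (trace_functional V (op_of (y i) o\<^sub>L op_of (x i))) (normalized_proj W)
    + fin_trace V (op_of (x i) o\<^sub>L op_of (y i)) *\<^sub>C rank_one (normalized_trace W) (normalized_proj W))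
    \<in> D_Lie"
    by (intro D_Lie_sum elementary_normalized_in_D_Lie V W x y)
  then show ?thesis
    by (simp add: sum.distrib sum_subtractf rank_one_sum_left rank_one_sum_right fin_trace_sum
        trace_functional_sum complex_vector.scale_sum_left)
qed

section \<open>Norm estimates for the correction terms\<close>

lemma norm_inner_functional_le: "norm (inner_functional w) \<le> norm w"
  using cmod_cinner_le [of _ w] by (intro norm_blinfun_bound) (simp_all add: mult.commute)

lemma norm_normalized_trace_le:
  assumes "orthonormal W"
  shows "norm (normalized_trace W) \<le> 1"
proof -
  have "norm (\<Sum>w\<in>W. coefficient (inner_functional w) w) \<le> (\<Sum>w\<in>W. 1)"
  proof (rule sum_norm_le)
    fix w assume "w \<in> W"
    then show "norm (coefficient (inner_functional w) w) \<le> 1"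
      using norm_coefficient_le [of "inner_functional w" w] norm_inner_functional_le [of w]
        norm_orthonormal [OF assms] by simp
  qed
  then show ?thesis
    by (cases "card W = 0") (simp_all add: normalized_trace_def norm_scaleC norm_divide divide_simps)
qed

lemma norm_normalized_proj_le:
  assumes "orthonormal W"
  shows "norm (normalized_proj W) \<le> 1 / card W"
proof -
  have "norm (blinfun_apply (op_of (normalized_proj W)) x) \<le> 1 / card W * norm x" for x
  proof -
    have "blinfun_apply (op_of (normalized_proj W)) x = (1 / of_nat (card W)) *\<^sub>C proj W x"
      by (simp add: normalized_proj_def proj_def op_of_simps blinfun_simps)
    then show ?thesis
      using norm_proj_le [OF assms, of x]
      \<comment> \<open>For empty \<open>W\<close> both sides vanish, because division by zero gives
        zero.\<close>
      by (cases "card W = 0") (simp_all add: norm_scaleC norm_divide divide_simps)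
  qed
  then show ?thesis
    unfolding norm_compact_op.rep_eq by (intro norm_blinfun_bound) simp_all
qed

text \<open>Of the three correction terms only the one with \<Sum> x y survives as \<open>W\<close>
  grows. The other two contain \<open>normalized_proj W\<close>, of norm at most 1 /
  \<open>card W\<close>, with factors bounded independently of \<open>W\<close>.\<close>

lemma sum_elementary_dist_D_Lie:
  fixes x y :: "'i \<Rightarrow> 'h :: complex_hilbert_space compact_op"
  assumes inf: "\<And>W :: 'h set. orthonormal W \<Longrightarrow> \<exists>y. proj W y \<noteq> y"
    and V: "orthonormal V"
    and x: "\<And>i a. i \<in> I \<Longrightarrow> proj V (blinfun_apply (op_of (x i)) a) = blinfun_apply (op_of (x i)) a"
    and y: "\<And>i a. i \<in> I \<Longrightarrow> proj V (blinfun_apply (op_of (y i)) a) = blinfun_apply (op_of (y i)) a"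
    and "\<delta> > 0"
  shows "\<exists>d\<in>D_Lie. norm ((\<Sum>i\<in>I. elementary (op_of (x i)) (op_of (y i))) - d)
    \<le> norm (\<Sum>i\<in>I. compact_mult (x i) (y i)) + \<delta>"
proof -
  let ?S = "\<Sum>i\<in>I. elementary (op_of (x i)) (op_of (y i))"
  let ?e = "\<Sum>i\<in>I. compact_mult (x i) (y i)"
  let ?t = "trace_functional V (\<Sum>i\<in>I. op_of (y i) o\<^sub>L op_of (x i))"
  let ?c = "fin_trace V (\<Sum>i\<in>I. op_of (x i) o\<^sub>L op_of (y i))"
  define K where "K = norm ?t + cmod ?c"
  obtain m :: nat where m: "K / \<delta> < m" using reals_Archimedean2 by blast
  \<comment> \<open>Taking \<open>Suc m\<close> elements keeps \<open>W\<close> nonempty even if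
    \<open>m = 0\<close>.\<close>
  obtain W :: "'h set" where W: "orthonormal W" "card W = Suc m"
    using orthonormal_card [OF inf] by blast
  then have W0: "W \<noteq> {}" by auto
  let ?\<tau> = "normalized_trace W" and ?q = "normalized_proj W"
  let ?d = "?S - rank_one ?\<tau> ?e - rank_one ?t ?q + ?c *\<^sub>C rank_one ?\<tau> ?q"
  have \<tau>: "norm ?\<tau> \<le> 1" by (rule norm_normalized_trace_le [OF W(1)])
  have q: "norm ?q \<le> 1 / Suc m"
    using norm_normalized_proj_le [OF W(1)] by (simp add: W(2))
  have "?d \<in> D_Lie"
    by (rule sum_elementary_normalized_in_D_Lie [OF V x y W(1) W0])
  moreover have "norm (?S - ?d) \<le> norm ?e + \<delta>"
  proof -
    have "?S - ?d = rank_one ?\<tau> ?e + (rank_one ?t ?q - ?c *\<^sub>C rank_one ?\<tau> ?q)"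
      by simp
    then have "norm (?S - ?d) \<le> norm (rank_one ?\<tau> ?e)
        + (norm (rank_one ?t ?q) + norm (?c *\<^sub>C rank_one ?\<tau> ?q))"
      by (simp only:) (rule order_trans [OF norm_triangle_ineq add_left_mono [OF norm_triangle_ineq4]])
    also have "norm (rank_one ?\<tau> ?e) \<le> norm ?e"
      using norm_rank_one_le [of ?\<tau> ?e] mult_right_mono [OF \<tau>, of "norm ?e"] by simp
    also have "norm (rank_one ?t ?q) \<le> norm ?t * (1 / Suc m)"
      using norm_rank_one_le [of ?t ?q] mult_left_mono [OF q, of "norm ?t"] by simp
    also have "norm (?c *\<^sub>C rank_one ?\<tau> ?q) \<le> cmod ?c * (1 / Suc m)"
    proof -
      have "norm (rank_one ?\<tau> ?q) \<le> 1 / Suc m"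
        using norm_rank_one_le [of ?\<tau> ?q] mult_mono [OF \<tau> q] by simp
      then show ?thesis
        unfolding norm_scaleC by (rule mult_left_mono) simp
    qed
    also have "norm ?t * (1 / Suc m) + cmod ?c * (1 / Suc m) = K / Suc m"
      by (simp add: K_def add_divide_distrib)
    also have "K / Suc m \<le> \<delta>"
    proof -
      have "K \<le> m * \<delta>" using m assms(5) by (simp add: field_simps)
      also have "\<dots> \<le> Suc m * \<delta>" using assms(5) by (intro mult_right_mono) simp_all
      finally show ?thesis by (simp add: field_simps)
    qed
    finally show ?thesis by simp
  qed
  ultimately show ?thesis by blast
qed


section \<open>Sums of elementary operators with compact coefficients\<close>

lemma bounded_bilinear_compact_mult:
  "bounded_bilinear (compact_mult :: 'h :: complex_hilbert_space compact_op \<Rightarrow> _)"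
proof
  fix a a' b b' :: "'h compact_op" and r :: real
  show "compact_mult (a + a') b = compact_mult a b + compact_mult a' b"
    and "compact_mult a (b + b') = compact_mult a b + compact_mult a b'"
    and "compact_mult (r *\<^sub>R a) b = r *\<^sub>R compact_mult a b"
    and "compact_mult a (r *\<^sub>R b) = r *\<^sub>R compact_mult a b"
    by (rule compact_op_eqI; simp add: op_of_compact_mult op_of_simps blinfun_simps
        blinfun.scaleR_left blinfun.scaleR_right)+
  show "\<exists>K. \<forall>a b :: 'h compact_op. norm (compact_mult a b) \<le> norm a * norm b * K"
    by (intro exI [of _ 1])
      (simp add: norm_compact_op.rep_eq op_of_compact_mult norm_blinfun_compose)
qed

lemma norm_elementary_le: "norm (elementary (op_of a) (op_of b)) \<le> norm a * norm b"
proof (rule norm_blinfun_bound)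
  fix z
  have "blinfun_apply (elementary (op_of a) (op_of b)) z = compact_mult a (compact_mult z b)"
    by (rule compact_op_eqI) (simp add: op_of_compact_mult)
  then have "norm (blinfun_apply (elementary (op_of a) (op_of b)) z) \<le> norm a * (norm z * norm b)"
    unfolding norm_compact_op.rep_eq op_of_compact_mult
    by (simp only:) (unfold op_of_compact_mult,
      rule order_trans [OF norm_blinfun_compose mult_left_mono [OF norm_blinfun_compose norm_ge_zero]])
  then show "norm (blinfun_apply (elementary (op_of a) (op_of b)) z) \<le> norm a * norm b * norm z"
    by (simp add: mult_ac)
qed simp

text \<open>Provides joint continuity, so that both coefficients can be approximated at
  once.\<close>

lemma bounded_bilinear_elementary:
  "bounded_bilinear (\<lambda>a b :: 'h :: complex_hilbert_space compact_op. elementary (op_of a) (op_of b))"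
proof
  fix a a' b b' :: "'h compact_op" and r :: real
  show "elementary (op_of (a + a')) (op_of b) = elementary (op_of a) (op_of b) + elementary (op_of a') (op_of b)"
    and "elementary (op_of a) (op_of (b + b')) = elementary (op_of a) (op_of b) + elementary (op_of a) (op_of b')"
    by (rule compact_op_map_eqI; simp add: op_of_simps blinfun_simps bounded_ops_add)+
  show "elementary (op_of (r *\<^sub>R a)) (op_of b) = r *\<^sub>R elementary (op_of a) (op_of b)"
    and "elementary (op_of a) (op_of (r *\<^sub>R b)) = r *\<^sub>R elementary (op_of a) (op_of b)"
    unfolding scaleR_scaleC
    by (rule compact_op_map_eqI; simp add: op_of_simps blinfun_simps bounded_ops_scale)+
  show "\<exists>K. \<forall>a b :: 'h compact_op. norm (elementary (op_of a) (op_of b)) \<le> norm a * norm b * K"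
    by (intro exI [of _ 1]) (simp add: norm_elementary_le)
qed

text \<open>Project the ranges of all coefficients into finite-dimensional spaces. The sum of
  products of the projected coefficients need not vanish, but it tends to zero, and by
  \<open>sum_elementary_dist_D_Lie\<close> it controls the distance to \<open>D_Lie\<close> up to an
  arbitrarily small error.\<close>

lemma infinite_dim_sum_elementary_in_closure:
  fixes x y :: "'i \<Rightarrow> 'h :: complex_hilbert_space compact_op"
  assumes inf: "\<And>W :: 'h set. orthonormal W \<Longrightarrow> \<exists>y. proj W y \<noteq> y"
    and "finite I" and xy: "(\<Sum>i\<in>I. compact_mult (x i) (y i)) = 0"
  shows "(\<Sum>i\<in>I. elementary (op_of (x i)) (op_of (y i))) \<in> closure D_Lie"
proof -
  have "\<exists>V. orthonormal V \<and> (\<forall>T\<in>op_of ` (x ` I \<union> y ` I). norm (T - (Proj V o\<^sub>L T)) \<le> inverse (real (Suc j)))" for j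
    by (rule compact_ops_proj_approx) (use \<open>finite I\<close> op_of in auto)
  then obtain V where V: "\<And>j. orthonormal (V j)"
    and approx: "\<And>j T. T \<in> op_of ` (x ` I \<union> y ` I) \<Longrightarrow> norm (T - (Proj (V j) o\<^sub>L T)) \<le> inverse (real (Suc j))"
    by metis
  \<comment> \<open>Multiplication from the left alone already puts the range into the span of
    \<open>V j\<close>, and this is all that the distance estimate asks of the coefficients.\<close>
  define P where "P j a = blinfun_apply (left_mult (Proj (V j))) a" for j and a :: "'h compact_op"
  have P: "op_of (P j a) = Proj (V j) o\<^sub>L op_of a" for j a
    by (simp add: P_def op_of_left_mult Proj_bounded_ops V)
  have lim: "(\<lambda>j. P j a) \<longlonglongrightarrow> a" if "a \<in> x ` I \<union> y ` I" for a
  proof -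
    have "norm (P j a - a) \<le> inverse (real (Suc j))" for j
      using approx [of "op_of a" j] that
      by (simp add: norm_compact_op.rep_eq op_of_simps P norm_minus_commute)
    then have "(\<lambda>j. P j a - a) \<longlonglongrightarrow> 0"
      by (intro Lim_null_comparison [OF _ LIMSEQ_inverse_real_of_nat]) simp
    then show ?thesis by (rule LIM_zero_cancel)
  qed
  define S where "S j = (\<Sum>i\<in>I. elementary (op_of (P j (x i))) (op_of (P j (y i))))" for j
  define e where "e j = (\<Sum>i\<in>I. compact_mult (P j (x i)) (P j (y i)))" for j
  have S: "S \<longlonglongrightarrow> (\<Sum>i\<in>I. elementary (op_of (x i)) (op_of (y i)))"
    unfolding S_def by (intro tendsto_sum bounded_bilinear.tendsto [OF bounded_bilinear_elementary] lim) auto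
  have "e \<longlonglongrightarrow> (\<Sum>i\<in>I. compact_mult (x i) (y i))"
    unfolding e_def by (intro tendsto_sum bounded_bilinear.tendsto [OF bounded_bilinear_compact_mult] lim) auto
  then have e: "(\<lambda>j. norm (e j)) \<longlonglongrightarrow> 0"
    unfolding xy by (rule tendsto_norm_zero)
  have "\<exists>d\<in>D_Lie. norm (S j - d) \<le> norm (e j) + inverse (real (Suc j))" for j
    unfolding S_def e_def
    by (rule sum_elementary_dist_D_Lie [OF inf V [of j]]) (simp_all add: P V proj_proj)
  then obtain d where d: "\<And>j. d j \<in> D_Lie" "\<And>j. norm (S j - d j) \<le> norm (e j) + inverse (real (Suc j))"
    by metis
  have "(\<lambda>j. norm (e j) + inverse (real (Suc j))) \<longlonglongrightarrow> 0 + 0"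
    by (intro tendsto_add e LIMSEQ_inverse_real_of_nat)
  then have "(\<lambda>j. S j - d j) \<longlonglongrightarrow> 0"
    using d(2) by (intro Lim_null_comparison [of "\<lambda>j. S j - d j" "\<lambda>j. norm (e j) + inverse (real (Suc j))"]) auto
  from tendsto_diff [OF S this]
  have "d \<longlonglongrightarrow> (\<Sum>i\<in>I. elementary (op_of (x i)) (op_of (y i)))" by simp
  then show ?thesis using d(1) closure_sequential by blast
qed

lemma finite_dim_sum_elementary_in_D_Lie:
  fixes x y :: "'i \<Rightarrow> 'h :: complex_hilbert_space compact_op"
  assumes V: "orthonormal V" and fd: "\<And>a :: 'h. proj V a = a"
    and xy: "(\<Sum>i\<in>I. op_of (x i) o\<^sub>L op_of (y i)) = 0"
    and yx: "(\<Sum>i\<in>I. op_of (y i) o\<^sub>L op_of (x i)) = 0"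
  shows "(\<Sum>i\<in>I. elementary (op_of (x i)) (op_of (y i))) \<in> D_Lie"
proof (cases "V = {}")
  \<comment> \<open>The normalized corrections require a nonempty set; here the space is zero and
    all its operators coincide.\<close>
  case True
  then have "a = (0 :: 'h)" for a
    using fd [of a] by (simp add: proj_def)
  then have "blinfun_apply (op_of a) v = blinfun_apply (op_of b) v" for a b :: "'h compact_op" and v
    by metis
  then have "(\<Sum>i\<in>I. elementary (op_of (x i)) (op_of (y i))) = 0"
    by (intro compact_op_map_eqI)
  then show ?thesis by (simp add: D_Lie_zero)
next
  case False
  have "(\<Sum>i\<in>I. compact_mult (x i) (y i)) = 0"
    using xy by (simp add: op_of_inject [symmetric] op_of_simps op_of_compact_mult)
  moreover have "trace_functional V 0 = 0" "fin_trace V 0 = 0"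
    using trace_functional_sum [of V "\<lambda>_. 0" "{}"] fin_trace_sum [of V "\<lambda>_. 0" "{}"] by simp_all
  ultimately show ?thesis
    using sum_elementary_normalized_in_D_Lie [OF V fd fd V False, where I = I and x = x and y = y] by (simp add: xy yx)
qed

section \<open>Comparison of the two algebras\<close>

lemma unitizationE:
  assumes "a \<in> unitization"
  obtains x c where "a = op_of x + c *\<^sub>C id_blinfun"
  using assms by (auto simp: unitization_def)

lemma op_of_in_unitization: "op_of x \<in> unitization"
  unfolding unitization_def by (rule CollectI, rule exI [of _ x], rule exI [of _ 0]) simp

lemma scaleC_id_in_unitization: "c *\<^sub>C id_blinfun \<in> unitization"
  unfolding unitization_def
  by (rule CollectI, rule exI [of _ 0], rule exI [of _ c]) (simp add: op_of_simps)

lemma compose_in_unitization: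
  assumes "a \<in> unitization" "b \<in> unitization"
  shows "a o\<^sub>L b \<in> unitization"
proof -
  obtain x c where a: "a = op_of x + c *\<^sub>C id_blinfun" using assms(1) by (rule unitizationE)
  obtain y d where b: "b = op_of y + d *\<^sub>C id_blinfun" using assms(2) by (rule unitizationE)
  have "a o\<^sub>L b = op_of (compact_mult x y + d *\<^sub>C x + c *\<^sub>C y) + (c * d) *\<^sub>C id_blinfun"
    by (rule blinfun_eqI)
      (simp add: a b op_of_simps op_of_compact_mult blinfun_simps scaleC_simps algebra_simps)
  then show ?thesis unfolding unitization_def by blast
qed

lemma in_bounded_ops_if_unitization: "a \<in> unitization \<Longrightarrow> a \<in> bounded_ops"
  using unitization_subset_bounded_ops by blast

text \<open>Admits any finite index set, so that \<open>bool\<close>, disjoint unions and products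
  can index the sums below.\<close>

lemma M_LieI:
  assumes "finite I" "\<And>i. i \<in> I \<Longrightarrow> a i \<in> unitization" "\<And>i. i \<in> I \<Longrightarrow> b i \<in> unitization"
    and "(\<Sum>i\<in>I. a i o\<^sub>L b i) = 0" "(\<Sum>i\<in>I. b i o\<^sub>L a i) = 0"
  shows "(\<Sum>i\<in>I. elementary (a i) (b i)) \<in> M_Lie"
proof -
  obtain h where h: "bij_betw h {..<card I} I"
    using ex_bij_betw_nat_finite [OF assms(1)] by (auto simp: atLeast0LessThan)
  note sums = sum.reindex_bij_betw [OF h]
  have "(\<Sum>i\<in>I. elementary (a i) (b i)) = (\<Sum>k<card I. left_mult (a (h k)) o\<^sub>L right_mult (b (h k)))"
    by (subst sums [symmetric]) (simp add: elementary_def)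
  moreover have "\<forall>k<card I. a (h k) \<in> unitization \<and> b (h k) \<in> unitization"
    using h assms(2,3) by (auto simp: bij_betw_def)
  moreover have "(\<Sum>k<card I. a (h k) o\<^sub>L b (h k)) = 0" "(\<Sum>k<card I. b (h k) o\<^sub>L a (h k)) = 0"
    using assms(4,5) sums [of "\<lambda>i. a i o\<^sub>L b i"] sums [of "\<lambda>i. b i o\<^sub>L a i"] by simp_all
  ultimately show ?thesis
    unfolding M_Lie_def
    by (intro CollectI exI [of _ "card I"] exI [of _ "\<lambda>k. a (h k)"] exI [of _ "\<lambda>k. b (h k)"] conjI)
qed

lemma M_LieE:
  assumes "T \<in> M_Lie"
  obtains n :: nat and a b where "T = (\<Sum>k<n. elementary (a k) (b k))"
    "\<And>k. k < n \<Longrightarrow> a k \<in> unitization" "\<And>k. k < n \<Longrightarrow> b k \<in> unitization"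
    "(\<Sum>k<n. a k o\<^sub>L b k) = 0" "(\<Sum>k<n. b k o\<^sub>L a k) = 0"
  using assms unfolding M_Lie_def elementary_def by blast

text \<open>The two terms are L_x R_1 and L_(-1) R_x; in either order their coefficient products are
  x and -x.\<close>

lemma inner_derivation_in_M_Lie: "inner_derivation x \<in> M_Lie"
proof -
  define a where "a i = (if i then op_of x else (-1) *\<^sub>C id_blinfun)" for i
  define b where "b i = (if i then 1 *\<^sub>C id_blinfun else op_of x)" for i
  have ab: "a i \<in> unitization" "b i \<in> unitization" for i
    by (cases i; simp only: a_def b_def if_True if_False op_of_in_unitization scaleC_id_in_unitization)+
  have "(\<Sum>i\<in>UNIV. elementary (a i) (b i)) \<in> M_Lie"
    by (rule M_LieI [OF finite ab])
      (auto simp: UNIV_bool a_def b_def intro!: blinfun_eqI simp: blinfun_simps)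
  also have "(\<Sum>i\<in>UNIV. elementary (a i) (b i)) = inner_derivation x"
    by (rule compact_op_map_eqI)
      (simp add: UNIV_bool blinfun_simps op_of_simps in_bounded_ops_if_unitization ab,
        simp add: a_def b_def blinfun_simps)
  finally show ?thesis .
qed

lemma subalgebra_M_Lie:
  "subalgebra (M_Lie :: ('h :: complex_hilbert_space compact_op \<Rightarrow>\<^sub>L 'h compact_op) set)"
  unfolding subalgebra_def
proof (intro conjI ballI allI)
  show "(0 :: 'h compact_op \<Rightarrow>\<^sub>L 'h compact_op) \<in> M_Lie"
    using M_LieI [of "{}"] by simp
next
  fix S T :: "'h compact_op \<Rightarrow>\<^sub>L 'h compact_op" and z :: complex
  assume "T \<in> M_Lie"
  then obtain n a b where T: "T = (\<Sum>k<n :: nat. elementary (a k) (b k))"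
    "\<And>k. k < n \<Longrightarrow> a k \<in> unitization" "\<And>k. k < n \<Longrightarrow> b k \<in> unitization"
    "(\<Sum>k<n. a k o\<^sub>L b k) = 0" "(\<Sum>k<n. b k o\<^sub>L a k) = 0"
    by (rule M_LieE) blast
  note Tb = T(2,3) [THEN in_bounded_ops_if_unitization]
  show "z *\<^sub>C T \<in> M_Lie"
  proof -
    have z: "(z *\<^sub>C id_blinfun) o\<^sub>L a k \<in> unitization" if "k < n" for k
      by (intro compose_in_unitization scaleC_id_in_unitization T that)
    have "z *\<^sub>C T = (\<Sum>k<n. elementary ((z *\<^sub>C id_blinfun) o\<^sub>L a k) (b k))"
      by (rule compact_op_map_eqI)
        (simp add: T(1) blinfun_simps op_of_simps complex_vector.scale_sum_right Tb
          in_bounded_ops_if_unitization [OF z])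
    moreover have "\<dots> \<in> M_Lie"
    proof (rule M_LieI)
      have "(\<Sum>k<n. ((z *\<^sub>C id_blinfun) o\<^sub>L a k) o\<^sub>L b k) = z *\<^sub>C (\<Sum>k<n. a k o\<^sub>L b k)"
        by (rule blinfun_eqI) (simp add: blinfun_simps complex_vector.scale_sum_right)
      then show "(\<Sum>k<n. ((z *\<^sub>C id_blinfun) o\<^sub>L a k) o\<^sub>L b k) = 0" by (simp add: T)
      have "(\<Sum>k<n. b k o\<^sub>L ((z *\<^sub>C id_blinfun) o\<^sub>L a k)) = z *\<^sub>C (\<Sum>k<n. b k o\<^sub>L a k)"
        using Tb by (intro blinfun_eqI)
          (simp add: blinfun_simps complex_vector.scale_sum_right bounded_ops_scaleC)
      then show "(\<Sum>k<n. b k o\<^sub>L ((z *\<^sub>C id_blinfun) o\<^sub>L a k)) = 0" by (simp add: T)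
    qed (use z T in auto)
    ultimately show ?thesis by simp
  qed
  assume "S \<in> M_Lie"
  then obtain m c d where S: "S = (\<Sum>k<m :: nat. elementary (c k) (d k))"
    "\<And>k. k < m \<Longrightarrow> c k \<in> unitization" "\<And>k. k < m \<Longrightarrow> d k \<in> unitization"
    "(\<Sum>k<m. c k o\<^sub>L d k) = 0" "(\<Sum>k<m. d k o\<^sub>L c k) = 0"
    by (rule M_LieE) blast
  note Sb = S(2,3) [THEN in_bounded_ops_if_unitization]
  show "S + T \<in> M_Lie"
  proof -
    let ?I = "{..<m} <+> {..<n}"
    have "(\<Sum>i\<in>?I. elementary (case_sum c a i) (case_sum d b i)) \<in> M_Lie"
      by (rule M_LieI) (auto simp: sum.Plus S T)
    then show ?thesis by (simp add: sum.Plus S(1) T(1))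
  qed
  show "S o\<^sub>L T \<in> M_Lie"
  proof -
    \<comment> \<open>The product of L_c R_d and L_a R_b is L_(ca) R_(bd). In \<Sum> c a b d the
      inner sum over ab vanishes by the condition on \<open>T\<close>; in \<Sum> b d c a the inner
      sum over dc vanishes by the condition on \<open>S\<close>.\<close>
    have mem: "c i o\<^sub>L a k \<in> unitization" "b k o\<^sub>L d i \<in> unitization" if "i < m" "k < n" for i k
      using that S T by (auto intro: compose_in_unitization)
    have "(\<Sum>(i,k)\<in>{..<m}\<times>{..<n}. elementary (c i o\<^sub>L a k) (b k o\<^sub>L d i)) \<in> M_Lie"
      unfolding case_prod_beta
    proof (rule M_LieI)
      have "(\<Sum>(i,k)\<in>{..<m}\<times>{..<n}. (c i o\<^sub>L a k) o\<^sub>L (b k o\<^sub>L d i))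
          = (\<Sum>i<m. c i o\<^sub>L ((\<Sum>k<n. a k o\<^sub>L b k) o\<^sub>L d i))"
        by (rule blinfun_eqI) (simp add: blinfun_simps flip: sum.cartesian_product)
      then show "(\<Sum>p\<in>{..<m}\<times>{..<n}. (c (fst p) o\<^sub>L a (snd p)) o\<^sub>L (b (snd p) o\<^sub>L d (fst p))) = 0"
        by (simp add: T case_prod_beta)
      have "(\<Sum>(i,k)\<in>{..<m}\<times>{..<n}. (b k o\<^sub>L d i) o\<^sub>L (c i o\<^sub>L a k))
          = (\<Sum>k<n. b k o\<^sub>L ((\<Sum>i<m. d i o\<^sub>L c i) o\<^sub>L a k))"
        unfolding sum.cartesian_product [symmetric]
        by (subst sum.swap, rule blinfun_eqI) (simp add: blinfun_simps)
      then show "(\<Sum>p\<in>{..<m}\<times>{..<n}. (b (snd p) o\<^sub>L d (fst p)) o\<^sub>L (c (fst p) o\<^sub>L a (snd p))) = 0"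
        by (simp add: S case_prod_beta)
    qed (use mem in auto)
    also have "(\<Sum>(i,k)\<in>{..<m}\<times>{..<n}. elementary (c i o\<^sub>L a k) (b k o\<^sub>L d i)) = S o\<^sub>L T"
    proof (rule compact_op_map_eqI)
      have "blinfun_apply (op_of (blinfun_apply (elementary (c i o\<^sub>L a k) (b k o\<^sub>L d i)) z)) v
        = blinfun_apply (op_of (blinfun_apply (elementary (c i) (d i)) (blinfun_apply (elementary (a k) (b k)) z))) v"
        if "i < m" "k < n" for i k z v
        using that Sb Tb by (simp add: bounded_ops_compose)
      then show "blinfun_apply (op_of (blinfun_apply
          (\<Sum>(i,k)\<in>{..<m}\<times>{..<n}. elementary (c i o\<^sub>L a k) (b k o\<^sub>L d i)) z)) v
        = blinfun_apply (op_of (blinfun_apply (S o\<^sub>L T) z)) v" for z v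
        by (simp add: S(1) T(1) blinfun_simps op_of_simps flip: sum.cartesian_product)
          (rule sum.swap)
    qed
    finally show ?thesis .
  qed
qed

lemma D_Lie_subset_M_Lie: "D_Lie \<subseteq> M_Lie"
  unfolding D_Lie_def
  by (rule hull_minimal) (auto simp: inner_derivation_in_M_Lie subalgebra_M_Lie)

lemma closure_D_Lie_add:
  assumes "S \<in> D_Lie" "T \<in> closure D_Lie"
  shows "S + T \<in> closure D_Lie"
proof -
  obtain t where t: "\<And>n. t n \<in> D_Lie" "t \<longlonglongrightarrow> T"
    using assms(2) by (auto simp: closure_sequential)
  have "(\<lambda>n. S + t n) \<longlonglongrightarrow> S + T"
    by (intro tendsto_intros t)
  then show ?thesis
    using D_Lie_add [OF assms(1) t(1)] unfolding closure_sequential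
    by (intro exI [of _ "\<lambda>n. S + t n"]) simp
qed

text \<open>A compact identity would lie within 1/2 of a finite-rank projection, but a nonzero
  vector in the kernel of that projection forces distance at least 1.\<close>

lemma id_not_compact:
  assumes inf: "\<And>W :: 'h :: complex_hilbert_space set. orthonormal W \<Longrightarrow> \<exists>y. proj W y \<noteq> y"
  shows "(id_blinfun :: 'h \<Rightarrow>\<^sub>L 'h) \<notin> compact_ops"
proof
  assume "(id_blinfun :: 'h \<Rightarrow>\<^sub>L 'h) \<in> compact_ops"
  then obtain W :: "'h set" where W: "orthonormal W"
    "norm (id_blinfun - (Proj W o\<^sub>L id_blinfun)) \<le> 1 / 2"
    using compact_ops_proj_approx [of "{id_blinfun}" "1 / 2"] by auto
  obtain y where y: "proj W y \<noteq> y" using inf [OF W(1)] by blast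
  define r where "r = y - proj W y"
  have "proj W r = 0" by (simp add: r_def proj_diff proj_proj W)
  then have "norm r \<le> norm (id_blinfun - (Proj W o\<^sub>L id_blinfun)) * norm r"
    using norm_blinfun [of "id_blinfun - (Proj W o\<^sub>L id_blinfun)" r] by (simp add: blinfun_simps W(1))
  also have "\<dots> \<le> 1 / 2 * norm r" by (intro mult_right_mono W) simp
  finally show False using y by (simp add: r_def)
qed

lemma M_Lie_subset_closure_D_Lie:
  "(M_Lie :: ('h :: complex_hilbert_space compact_op \<Rightarrow>\<^sub>L 'h compact_op) set) \<subseteq> closure D_Lie"
proof
  fix T :: "'h compact_op \<Rightarrow>\<^sub>L 'h compact_op"
  assume "T \<in> M_Lie"
  then obtain n a b where T: "T = (\<Sum>k<n :: nat. elementary (a k) (b k))"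
    and ab: "\<And>k. k < n \<Longrightarrow> a k \<in> unitization" "\<And>k. k < n \<Longrightarrow> b k \<in> unitization"
    and sums: "(\<Sum>k<n. a k o\<^sub>L b k) = 0" "(\<Sum>k<n. b k o\<^sub>L a k) = 0"
    by (rule M_LieE) blast
  note bounded = ab [THEN in_bounded_ops_if_unitization]
  show "T \<in> closure D_Lie"
  proof (cases "\<exists>V :: 'h set. orthonormal V \<and> (\<forall>v. proj V v = v)")
    case True
    then obtain V :: "'h set" where V: "orthonormal V" "\<And>v. proj V v = v" by blast
    \<comment> \<open>In finite dimension every bounded operator is compact; \<open>P\<close>
      rewrites the coefficients, scalar parts included, as elements of K(H).\<close>
    define P where "P c = (\<Sum>v\<in>V. compact_rank_one (inner_functional v o\<^sub>L c) v)" for c :: "'h \<Rightarrow>\<^sub>L 'h"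
    have P: "op_of (P c) = c" if "c \<in> bounded_ops" for c
    proof (rule blinfun_eqI)
      fix v
      show "blinfun_apply (op_of (P c)) v = blinfun_apply c v"
        using that V(2) [of "blinfun_apply c v"]
        by (simp add: P_def op_of_simps blinfun_simps bounded_ops_compose proj_def)
    qed
    have "(\<Sum>k<n. elementary (op_of (P (a k))) (op_of (P (b k)))) \<in> D_Lie"
      by (rule finite_dim_sum_elementary_in_D_Lie [OF V]) (simp_all add: P bounded sums)
    then show ?thesis
      using closure_subset by (auto simp: T P bounded)
  next
    case False
    then have inf: "\<exists>y. proj W y \<noteq> y" if "orthonormal W" for W :: "'h set"
      using that by blast
    have "\<forall>k. \<exists>x c. k < n \<longrightarrow> a k = op_of x + c *\<^sub>C id_blinfun"
      "\<forall>k. \<exists>y d. k < n \<longrightarrow> b k = op_of y + d *\<^sub>C id_blinfun"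
      using ab by (auto simp: unitization_def)
    then obtain x c y d where a: "\<And>k. k < n \<Longrightarrow> a k = op_of (x k) + c k *\<^sub>C id_blinfun"
      and b: "\<And>k. k < n \<Longrightarrow> b k = op_of (y k) + d k *\<^sub>C id_blinfun"
      by metis
    define s where "s = (\<Sum>k<n. compact_mult (x k) (y k))"
    define t where "t = (\<Sum>k<n. compact_mult (y k) (x k))"
    define x' where "x' = (\<Sum>k<n. d k *\<^sub>C x k)"
    define y' where "y' = (\<Sum>k<n. c k *\<^sub>C y k)"
    define \<gamma> where "\<gamma> = (\<Sum>k<n. c k * d k)"
    \<comment> \<open>The two defining conditions of \<open>M_Lie\<close>, split into compact and
      scalar parts. They share the scalar \<open>\<gamma>\<close> and the compact terms
      \<open>x'\<close> and \<open>y'\<close>.\<close>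
    have st: "op_of (s + x' + y') + \<gamma> *\<^sub>C id_blinfun = 0" "op_of (t + x' + y') + \<gamma> *\<^sub>C id_blinfun = 0"
    proof -
      have "op_of (s + x' + y') + \<gamma> *\<^sub>C id_blinfun = (\<Sum>k<n. a k o\<^sub>L b k)"
        by (rule blinfun_eqI)
          (simp add: a b s_def x'_def y'_def \<gamma>_def op_of_simps op_of_compact_mult blinfun_simps
            scaleC_simps complex_vector.scale_sum_left sum.distrib algebra_simps)
      then show "op_of (s + x' + y') + \<gamma> *\<^sub>C id_blinfun = 0" by (simp add: sums)
      have "op_of (t + x' + y') + \<gamma> *\<^sub>C id_blinfun = (\<Sum>k<n. b k o\<^sub>L a k)"
        by (rule blinfun_eqI)
          (simp add: a b t_def x'_def y'_def \<gamma>_def op_of_simps op_of_compact_mult blinfun_simps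
            scaleC_simps complex_vector.scale_sum_left sum.distrib algebra_simps)
      then show "op_of (t + x' + y') + \<gamma> *\<^sub>C id_blinfun = 0" by (simp add: sums)
    qed
    \<comment> \<open>Otherwise the identity would be a multiple of a compact operator.\<close>
    have \<gamma>: "\<gamma> = 0"
    proof (rule ccontr)
      assume "\<gamma> \<noteq> 0"
      have "\<gamma> *\<^sub>C id_blinfun = - op_of (s + x' + y')"
        using st(1) by (simp add: eq_neg_iff_add_eq_0 add.commute)
      then have "\<gamma> *\<^sub>C id_blinfun = op_of (- (s + x' + y'))"
        by (simp only: uminus_compact_op.rep_eq)
      then have "inverse \<gamma> *\<^sub>C \<gamma> *\<^sub>C (id_blinfun :: 'h \<Rightarrow>\<^sub>L 'h) \<in> compact_ops"
        by (metis op_of scaleC_in_compact_ops)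
      then show False
        using id_not_compact [OF inf] \<open>\<gamma> \<noteq> 0\<close> by (simp add: scaleC_scaleC)
    qed
    have s: "s + x' + y' = 0" and t: "t + x' + y' = 0"
      using st by (simp_all add: \<gamma> op_of_simps(1) flip: op_of_inject)
    then have ts: "t = s" by (simp add: add.assoc eq_neg_iff_add_eq_0 [symmetric])
    \<comment> \<open>Adding \<open>1/2 \<Sum> ad x\<^sub>k ad y\<^sub>k\<close> antisymmetrizes \<open>\<Sum> x\<^sub>k \<otimes> y\<^sub>k\<close> and, since \<open>s = t\<close>, cancels the one-sided terms
      modulo derivations.\<close>
    define p where "p i = (if snd i then (1/2) *\<^sub>C x (fst i) else (-1/2) *\<^sub>C y (fst i))" for i
    define q where "q i = (if snd i then y (fst i) else x (fst i))" for i
    let ?I = "{..<n} \<times> (UNIV :: bool set)"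
    have "(\<Sum>i\<in>?I. compact_mult (p i) (q i)) = (\<Sum>k<n. \<Sum>j\<in>UNIV. compact_mult (p (k,j)) (q (k,j)))"
      by (subst sum.cartesian_product) (simp add: case_prod_beta)
    also have "\<dots> = (1/2) *\<^sub>C s - (1/2) *\<^sub>C t"
      unfolding s_def t_def
      by (rule compact_op_eqI)
        (simp add: UNIV_bool p_def q_def op_of_simps op_of_compact_mult blinfun_simps sum.distrib
          sum_negf complex_vector.scale_sum_right)
    finally have "(\<Sum>i\<in>?I. compact_mult (p i) (q i)) = 0" by (simp add: ts)
    then have "(\<Sum>i\<in>?I. elementary (op_of (p i)) (op_of (q i))) \<in> closure D_Lie"
      by (intro infinite_dim_sum_elementary_in_closure inf) auto
    moreover have "inner_derivation x' + (1/2) *\<^sub>C inner_derivation s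
        - (1/2) *\<^sub>C (\<Sum>k<n. inner_derivation (x k) o\<^sub>L inner_derivation (y k)) \<in> D_Lie"
      by (intro D_Lie_intros D_Lie_sum)
    ultimately have "(inner_derivation x' + (1/2) *\<^sub>C inner_derivation s
        - (1/2) *\<^sub>C (\<Sum>k<n. inner_derivation (x k) o\<^sub>L inner_derivation (y k)))
        + (\<Sum>i\<in>?I. elementary (op_of (p i)) (op_of (q i))) \<in> closure D_Lie"
      by (rule closure_D_Lie_add [rotated])
    also have "(inner_derivation x' + (1/2) *\<^sub>C inner_derivation s
        - (1/2) *\<^sub>C (\<Sum>k<n. inner_derivation (x k) o\<^sub>L inner_derivation (y k)))
        + (\<Sum>i\<in>?I. elementary (op_of (p i)) (op_of (q i))) = T"
    proof (rule compact_op_map_eqI)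
      fix z :: "'h compact_op" and v :: 'h
      let ?z = "blinfun_apply (op_of z)"
      define X where "X = (\<Sum>k<n. blinfun_apply (op_of (x k)) (?z (blinfun_apply (op_of (y k)) v)))"
      define Y where "Y = (\<Sum>k<n. blinfun_apply (op_of (y k)) (?z (blinfun_apply (op_of (x k)) v)))"
      define A where "A = blinfun_apply (op_of x') (?z v)"
      define B where "B = ?z (blinfun_apply (op_of x') v)"
      define C where "C = blinfun_apply (op_of s) (?z v)"
      define D where "D = ?z (blinfun_apply (op_of s) v)"
      have C: "(\<Sum>k<n. blinfun_apply (op_of (x k)) (blinfun_apply (op_of (y k)) (?z v))) = C"
        by (simp add: C_def s_def op_of_simps op_of_compact_mult blinfun_simps)
      \<comment> \<open>These terms sum to z t; the equality of \<open>t\<close> and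
        \<open>s\<close> turns this into z s.\<close>
      have D: "(\<Sum>k<n. ?z (blinfun_apply (op_of (y k)) (blinfun_apply (op_of (x k)) v))) = D"
        unfolding D_def ts [symmetric]
        by (simp add: t_def op_of_simps op_of_compact_mult blinfun_simps)
      \<comment> \<open>Hence the one-sided terms of \<open>T\<close> are ad x' minus right
        multiplication by \<open>s\<close>.\<close>
      have "y' = - s - x'" using s by (simp add: algebra_simps eq_neg_iff_add_eq_0)
      then have y': "?z (blinfun_apply (op_of y') v) = - D - B"
        by (simp add: op_of_simps blinfun_simps D_def B_def)
      have "blinfun_apply (op_of (blinfun_apply T z)) v
          = X + A + ?z (blinfun_apply (op_of y') v) + \<gamma> *\<^sub>C ?z v"
        by (simp add: T bounded op_of_simps blinfun_simps)
          (simp add: a b X_def A_def x'_def y'_def \<gamma>_def op_of_simps blinfun_simps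
            scaleC_simps complex_vector.scale_sum_left sum.distrib algebra_simps)
      then have T': "blinfun_apply (op_of (blinfun_apply T z)) v = X + A + (- D - B)"
        by (simp add: \<gamma> y')
      have ad: "blinfun_apply (op_of (blinfun_apply
          (\<Sum>k<n. inner_derivation (x k) o\<^sub>L inner_derivation (y k)) z)) v = C - X - Y + D"
        by (simp add: op_of_simps blinfun_simps sum_subtractf C D X_def [symmetric] Y_def [symmetric])
      have pq: "blinfun_apply (op_of (blinfun_apply (\<Sum>i\<in>?I. elementary (op_of (p i)) (op_of (q i))) z)) v
          = (1/2) *\<^sub>C X - (1/2) *\<^sub>C Y"
        by (simp add: op_of_simps blinfun_simps)
          (simp add: sum.cartesian_product' UNIV_bool p_def q_def op_of_simps blinfun_simps sum.distrib
            X_def Y_def complex_vector.scale_sum_right sum_subtractf)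
      have half: "(1/2) *\<^sub>C w + (1/2) *\<^sub>C w = w" for w :: 'h
        by (simp flip: scaleC_add_left)
      have "A - B + ((1/2) *\<^sub>C C - (1/2) *\<^sub>C D) - (1/2) *\<^sub>C (C - X - Y + D) + ((1/2) *\<^sub>C X - (1/2) *\<^sub>C Y)
          = ((1/2) *\<^sub>C X + (1/2) *\<^sub>C X) + A + (- ((1/2) *\<^sub>C D + (1/2) *\<^sub>C D) - B)"
        by (simp add: scaleC_simps algebra_simps)
      then have "A - B + (1/2) *\<^sub>C (C - D) - (1/2) *\<^sub>C (C - X - Y + D) + ((1/2) *\<^sub>C X - (1/2) *\<^sub>C Y)
          = X + A + (- D - B)"
        unfolding half by (simp only: complex_vector.scale_right_diff_distrib)
      then show "blinfun_apply (op_of (blinfun_apply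
          ((inner_derivation x' + (1/2) *\<^sub>C inner_derivation s
            - (1/2) *\<^sub>C (\<Sum>k<n. inner_derivation (x k) o\<^sub>L inner_derivation (y k)))
          + (\<Sum>i\<in>?I. elementary (op_of (p i)) (op_of (q i)))) z)) v
          = blinfun_apply (op_of (blinfun_apply T z)) v"
        unfolding T' blinfun.add_left blinfun.diff_left plus_compact_op.rep_eq
          minus_compact_op.rep_eq pq blinfun_apply_scaleC scaleC_compact_op.rep_eq ad
        by (simp add: A_def B_def C_def D_def)
    qed
    finally show ?thesis .
  qed
qed

text \<open>\<open>D_Lie\<close> lies in \<open>M_Lie\<close>, which lies in the closure of
  \<open>D_Lie\<close>.\<close>

theorem theorem4p5:
  assumes "separable_space (euclidean :: 'h :: complex_hilbert_space topology)"
  shows "closure (D_Lie :: ('h compact_op \<Rightarrow>\<^sub>L 'h compact_op) set) = closure M_Lie"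
  using closure_mono [OF D_Lie_subset_M_Lie] closure_minimal [OF M_Lie_subset_closure_D_Lie]
  by blast

end
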